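(* Let $s_1,s_2>1$ and $p,q,r>0$ be fixed, and let $W_a$ and $\mu_a$ be the maps and measures defined in the context. As $a\to 0^+$, the measures $\mu_a$ converge $*$-weakly to the measure (I) $\delta_{(1/2)}$, if $\frac1{s_1}+\frac1{s_2}>1$; (II) $\displaystyle \frac{(qs_1+ps_2-p-q)(s_2+2)}{(qs_1+ps_2-p-q)(s_2+2)+2rs_1s_2^2}\,\mu_0+\frac{2rs_1s_2^2}{(qs_1+ps_2-p-q)(s_2+2)+2rs_1s_2^2}\,\delta_{(1/2)}$, if $\frac1{s_1}+\frac1{s_2}=1$; (III) $\mu_0$, if $\frac1{s_1}+\frac1{s_2}<1$. Here $\delta_{(1/2)}$ is the Dirac measure at the point $1/2$.
   Context: Fix $s_1,s_2>1$ and $p,q,r>0$. For $a\ge 0$ define $$W_a(x)=\begin{cases} 1-\frac{2(s_1+pa)}{s_1-1+pa-2ra}\,x, & 0\le x<\frac12-\frac{\frac12+ra}{s_1+pa},\\ (s_1+pa)(x-\tfrac12)+\tfrac12+ra, & \frac12-\frac{\frac12+ra}{s_1+pa}\le x<\frac12,\\ -(s_2+qa)(x-\tfrac12)+\tfrac12+ra, & \frac12\le x<\frac12+\frac{\frac12+ra}{s_2+qa},\\ 1+\frac{2(s_2+qa)}{s_2-1+qa-2ra}\,(x-1), & \frac12+\frac{\frac12+ra}{s_2+qa}\le x\le 1.\end{cases}$$ Only those $a\ge 0$ are considered for which $0\le W_a(x)\le 1$ for all $x\in[0,1]$ (this holds for $a=0$ and for all sufficiently small $a>0$). All slopes of $W_a$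 exceed $1$ in modulus, and $W_a$ has a unique absolutely continuous (with respect to Lebesgue measure) invariant probability measure, denoted $\mu_a$; in particular $\mu_0$ is that of $W_0$. $*$-weak convergence of probability measures means convergence of integrals of every continuous function on $[0,1]$. *)

theory Defs
  imports "HOL-Probability.Probability"
begin

definition W :: "real \<Rightarrow> real \<Rightarrow> real \<Rightarrow> real \<Rightarrow> real \<Rightarrow> real \<Rightarrow> real \<Rightarrow> real" where
  "W s1 s2 p q r a x =
     (if x < 1/2 - (1/2 + r * a) / (s1 + p * a) then
        1 - 2 * (s1 + p * a) / (s1 - 1 + p * a - 2 * r * a) * x
      else if x < 1/2 then
        (s1 + p * a) * (x - 1/2) + 1/2 + r * a
      else if x < 1/2 + (1/2 + r * a) / (s2 + q * a) then
        - (s2 + q * a) * (x - 1/2) + 1/2 + r * a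
      else
        1 + 2 * (s2 + q * a) / (s2 - 1 + q * a - 2 * r * a) * (x - 1))"

text \<open>The formula for \<open>W\<close> is only meaningful for \<open>x\<close> in \<open>[0,1]\<close>; all measures below live on
  the Borel space of \<open>[0,1]\<close>, so the values of \<open>W\<close> elsewhere play no role.\<close>

definition admissible :: "real \<Rightarrow> real \<Rightarrow> real \<Rightarrow> real \<Rightarrow> real \<Rightarrow> real \<Rightarrow> bool" where
  "admissible s1 s2 p q r a \<longleftrightarrow>
     0 \<le> a \<and> (\<forall>x\<in>{0..1}. 0 \<le> W s1 s2 p q r a x \<and> W s1 s2 p q r a x \<le> 1)"

abbreviation unit_borel :: "real measure" where
  "unit_borel \<equiv> restrict_space borel {0..1}"

definition acim :: "(real \<Rightarrow> real) \<Rightarrow> real measure \<Rightarrow> bool" where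
  "acim T M \<longleftrightarrow>
     prob_space M \<and> sets M = sets unit_borel \<and>
     absolutely_continuous (restrict_space lborel {0..1}) M \<and>
     T \<in> measurable M M \<and> distr M M T = M"

definition weak_star_conv :: "(real \<Rightarrow> real measure) \<Rightarrow> real measure \<Rightarrow> real filter \<Rightarrow> bool" where
  "weak_star_conv \<mu> \<nu> F \<longleftrightarrow>
     (\<forall>f :: real \<Rightarrow> real. continuous_on {0..1} f \<longrightarrow>
        ((\<lambda>a. \<integral>x. f x \<partial>\<mu> a) \<longlongrightarrow> (\<integral>x. f x \<partial>\<nu>)) F)"

definition lincomb_measure :: "real \<Rightarrow> 'a measure \<Rightarrow> real \<Rightarrow> 'a measure \<Rightarrow> 'a measure" where
  "lincomb_measure c M d N =
     measure_of (space M) (sets M) (\<lambda>A. ennreal c * emeasure M A + ennreal d * emeasure N A)"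

lemma sets_lincomb_measure [simp]: "sets (lincomb_measure c M d N) = sets M"
  and space_lincomb_measure [simp]: "space (lincomb_measure c M d N) = space M"
  by (simp_all add: lincomb_measure_def)

lemma emeasure_lincomb_measure:
  assumes "sets N = sets M" and A: "A \<in> sets M"
  shows "emeasure (lincomb_measure c M d N) A =
           ennreal c * emeasure M A + ennreal d * emeasure N A"
proof (rule emeasure_measure_of[OF lincomb_measure_def])
  show "sets M \<subseteq> Pow (space M)" by (rule sets.space_closed)
  show "A \<in> sets (lincomb_measure c M d N)" using A by simp
  show "positive (sets (lincomb_measure c M d N))
          (\<lambda>A. ennreal c * emeasure M A + ennreal d * emeasure N A)"
    by (simp add: positive_def)
  show "countably_additive (sets (lincomb_measure c M d N))
          (\<lambda>A. ennreal c * emeasure M A + ennreal d * emeasure N A)"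
    using assms(1)
    by (auto simp: countably_additive_def suminf_add[symmetric] ennreal_suminf_cmult
          suminf_emeasure)
qed

end

theory Submission
  imports Defs
begin

text \<open>
  The slopes may be arbitrarily close to 1 in modulus, and since the limits in the first two cases
  contain a point mass, the invariant densities are not bounded uniformly in \<open>a\<close>. The proof
  therefore computes every absolutely continuous invariant measure in terms of the orbit of the
  turning value, and then follows that orbit as \<open>a\<close> tends to 0.

  \<^bold>\<open>Exact formula for fixed \<open>a\<close>.\<close> Write \<open>c = 1/2 + r a\<close> for the turning value, \<open>x\<^sub>k\<close> for the \<open>k\<close>-th
  iterate of \<open>c\<close> and \<open>D\<^sub>k\<close> for the inverse of the slope of the \<open>k\<close>-th iterate of the map at \<open>c\<close>.
  The transfer operator sends the indicator function of \<open>[0,t]\<close> to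
  a multiple of the indicator of \<open>[0, T t]\<close> plus a combination of the constant 1 and the indicator
  of \<open>[0,c]\<close>, because both outer branches are onto and both inner branches map onto \<open>[0,c]\<close>. This
  suggests the density \<open>A + C \<Sum>\<^sub>k D\<^sub>k \<chi>[0,x\<^sub>k]\<close>, with \<open>\<chi>\<close> for indicator functions, that is,
  \<open>\<integral> f d\<mu> = A F(1) + C \<Sum>\<^sub>k D\<^sub>k F(x\<^sub>k)\<close> with \<open>F\<close> the primitive of \<open>f\<close> vanishing at 0. That every
  absolutely continuous invariant measure has this form is proved dually. Composing a test function
  with the map leaves its integral unchanged while its primitive is multiplied by an inverse slope,
  hence contracted, apart from one jump at the turning point. A correction of the test function,
  whose size is governed by a telescoping sum, removes the jump. The primitives then tend to 0
  uniformly, and so do the integrals, by absolute continuity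
  (\<open>vanishing_primitives_imp_vanishing_integrals\<close>, \<open>integral_mean_zero\<close>). Invariance also gives two
  linear relations between \<open>A\<close> and \<open>C\<close> (\<open>acim_integral_formula\<close>), which together with the total
  mass 1 determine the measure.

  \<^bold>\<open>The orbit of the turning value.\<close> For \<open>a = 0\<close> it is the fixed point 1/2
  (\<open>orbit_sum_at_fixed_turning_point\<close>). If \<open>1/s\<^sub>1 + 1/s\<^sub>2 > 1\<close>, then for small \<open>a > 0\<close> it is trapped in an
  invariant interval of length \<open>O(a)\<close> around 1/2, and the two relations force \<open>A = 0\<close> and
  \<open>\<Sum>\<^sub>k D\<^sub>k = 0\<close>: all mass lies in that interval (\<open>trapped_integral_eq_0\<close>). In the other two cases
  the second iterate of 1/2 lies at a distance \<open>e\<close> to the left of the repelling fixed point \<open>y\<close> of the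
  second branch, and the orbit moves away from \<open>y\<close> geometrically until it leaves the branch after
  a number of steps of order \<open>log(1/e)\<close>. Replacing it by a constant orbit at \<open>y\<close> costs \<open>O(e\<^bsup>3/4\<^esup>)\<close>
  (\<open>escaping_orbit_sum\<close>), which gives
  \<open>\<Sum>\<^sub>k D\<^sub>k F(x\<^sub>k) = F(c) - S\<^sub>1 / (S\<^sub>2 (S\<^sub>1 - 1)) F(y) + O(e\<^bsup>3/4\<^esup>)\<close>.

  \<^bold>\<open>The limit.\<close> If \<open>1/s\<^sub>1 + 1/s\<^sub>2 < 1\<close>, both \<open>c\<close> and \<open>y\<close> tend to 1/2, and the sum tends to
  a positive multiple of \<open>F(1/2)\<close>, just as in the formula for \<open>\<mu>\<^sub>0\<close>. If \<open>1/s\<^sub>1 + 1/s\<^sub>2 = 1\<close>, the sum is of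
  order \<open>a\<close>, while \<open>e\<close> is of order \<open>a\<^sup>2\<close> and the error is \<open>o(a)\<close>. After division by \<open>a\<close> the coefficient
  of \<open>F(1/2)\<close> again produces \<open>\<mu>\<^sub>0\<close>, and the increments \<open>F(c) - F(1/2)\<close> and \<open>F(y) - F(1/2)\<close>, which are of
  order \<open>a\<close> with factor \<open>F'(1/2) = f(1/2)\<close>, produce the point mass (\<open>escaping_limit\<close>).
\<close>

section \<open>Test functions with vanishing primitives\<close>

text \<open>
  A Riemann--Lebesgue lemma: a bounded sequence whose integrals over all half-lines tend to 0
  converges to 0 weakly-* in \<open>L\<^sup>\<infinity>\<close>. The Borel sets over which the integrals tend to 0 form a Dynkin
  system containing the half-lines, and simple functions are dense in \<open>L\<^sup>1\<close>.
\<close>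

lemma integral_times_vanishing_averages:
  fixes V :: "nat \<Rightarrow> real \<Rightarrow> real" and h :: "real \<Rightarrow> real"
  assumes V: "\<And>n. integrable lborel (V n)"
    and bound: "\<And>n x. \<bar>V n x\<bar> \<le> B * indicator {0..1} x"
    and avg: "\<And>t. (\<lambda>n. \<integral>x. indicator {..t} x * V n x \<partial>lborel) \<longlonglongrightarrow> 0"
    and h: "integrable lborel h"
  shows "(\<lambda>n. \<integral>x. h x * V n x \<partial>lborel) \<longlonglongrightarrow> 0"
proof -
  have [measurable]: "V n \<in> borel_measurable borel" for n
    using V[of n] by (auto dest: borel_measurable_integrable)
  have VB: "\<bar>V n x\<bar> \<le> B" for n x
  proof -
    have "0 \<le> B" using bound[of n 0] by (auto intro: order_trans[OF abs_ge_zero])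
    then show ?thesis using bound[of n x] by (cases "x \<in> {0..1}") auto
  qed
  have int_AV: "integrable lborel (\<lambda>x. indicator A x * V n x)" if "A \<in> sets borel" for A n
    using integrable_mult_indicator[OF _ V[of n], of A] that by simp
  have I1: "integrable lborel (\<lambda>x::real. B * indicator {0..1} x)" by simp
  have indi: "(\<lambda>n. \<integral>x. indicator A x * V n x \<partial>lborel) \<longlonglongrightarrow> 0" if "A \<in> sets borel" for A
  proof -
    have A: "A \<in> sigma_sets UNIV (range (\<lambda>t::real. {..t}))"
      using that by (simp add: borel_eq_atMost)
    have "Int_stable (range (\<lambda>t::real. {..t}))"
    proof (rule Int_stableI_image)
      fix s t :: real
      show "\<exists>k\<in>UNIV. {..s} \<inter> {..t} = {..k}"
        by (intro bexI[of _ "min s t"]) auto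
    qed
    moreover have "range (\<lambda>t::real. {..t}) \<subseteq> Pow UNIV" by simp
    ultimately show ?thesis using A
    proof (induction rule: sigma_sets_induct_disjoint)
      case (basic A)
      then show ?case using avg by auto
    next
      case empty
      then show ?case by simp
    next
      case (compl A)
      have A: "A \<in> sets borel" using compl(1) by (simp add: borel_eq_atMost)
      have one: "(\<integral>x. indicator {..1} x * V n x \<partial>lborel) = (\<integral>x. V n x \<partial>lborel)" for n
      proof (rule Bochner_Integration.integral_cong)
        fix x :: real
        show "indicator {..1} x * V n x = V n x"
          using bound[of n x] by (auto simp: indicator_def split: if_splits)
      qed simp
      have "(\<integral>x. indicator (UNIV - A) x * V n x \<partial>lborel)
          = (\<integral>x. V n x \<partial>lborel) - (\<integral>x. indicator A x * V n x \<partial>lborel)" for n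
        by (subst Bochner_Integration.integral_diff[symmetric, OF V int_AV[OF A]])
           (auto intro!: Bochner_Integration.integral_cong simp: indicator_def)
      then show ?case
        using tendsto_diff[OF avg[of 1] compl(2)] by (simp add: one)
    next
      case (union A)
      have A: "A i \<in> sets borel" for i using union(2) by (auto simp: borel_eq_atMost)
      have UN: "(\<Union>i. A i) \<in> sets borel" using A by auto
      let ?m = "\<lambda>i. \<integral>x. B * (indicator (A i) x * indicator {0..1} x) \<partial>lborel"
      have Aint: "integrable lborel (\<lambda>x. B * (indicator (A i) x * indicator {0..1} x))" for i
        using integrable_mult_indicator[OF _ I1, of "A i"] A by (simp add: ac_simps)
      have disj_sums: "(\<lambda>i. indicator (A i) x * y) sums (indicator (\<Union>i. A i) x * y)"
        for x y :: real
        using sums_mult2[OF indicator_sums[of A x]] union(1)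
        by (auto simp: disjoint_family_on_def)
      have sm: "(\<lambda>i. \<integral>x. indicator (A i) x * g x \<partial>lborel) sums
                 (\<integral>x. indicator (\<Union>i. A i) x * g x \<partial>lborel)"
        if g: "integrable lborel g" for g :: "real \<Rightarrow> real"
      proof -
        have [measurable]: "g \<in> borel_measurable borel" "\<And>i. A i \<in> sets borel"
          using borel_measurable_integrable[OF g] A by auto
        have gA: "integrable lborel (\<lambda>x. indicator (A i) x * g x)" for i
          using integrable_mult_indicator[OF _ g, of "A i"] A by simp
        have part: "(\<Sum>i<n. indicator (A i) x * g x) = indicator (\<Union>i<n. A i) x * g x" for n x
          by (subst indicator_UN_disjoint)
             (use union(1) in \<open>auto simp: disjoint_family_on_def sum_distrib_right\<close>)
        have "(\<lambda>n. \<integral>x. (\<Sum>i<n. indicator (A i) x * g x) \<partial>lborel) \<longlonglongrightarrow>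
               (\<integral>x. indicator (\<Union>i. A i) x * g x \<partial>lborel)"
        proof (rule integral_dominated_convergence[where w = "\<lambda>x. \<bar>g x\<bar>"])
          show "AE x in lborel. (\<lambda>n. \<Sum>i<n. indicator (A i) x * g x) \<longlonglongrightarrow> indicator (\<Union>i. A i) x * g x"
            using disj_sums by (auto simp: sums_def)
          show "AE x in lborel. norm (\<Sum>i<n. indicator (A i) x * g x) \<le> \<bar>g x\<bar>" for n
            unfolding part by (auto simp: indicator_def)
        qed (use g in auto)
        then have "(\<lambda>n. \<Sum>i<n. \<integral>x. indicator (A i) x * g x \<partial>lborel) \<longlonglongrightarrow>
               (\<integral>x. indicator (\<Union>i. A i) x * g x \<partial>lborel)"
          by (subst (asm) Bochner_Integration.integral_sum) (use gA in auto)
        then show ?thesis by (simp only: sums_def)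
      qed
      have "summable ?m"
        using sums_summable[OF sm[OF I1]] by (simp add: ac_simps)
      moreover have "norm (\<integral>x. indicator (A i) x * V n x \<partial>lborel) \<le> ?m i" for i n
        by (rule Bochner_Integration.integral_norm_bound_integral[OF int_AV[OF A] Aint])
           (use bound in \<open>auto simp: indicator_def abs_mult\<close>)
      \<comment> \<open>The integral over \<open>A i\<close> is at most \<open>B\<close> times the length of \<open>A i\<close> in \<open>[0,1]\<close>, uniformly in \<open>n\<close>,
        so limit and sum may be exchanged.\<close>
      ultimately have "(\<lambda>n. \<Sum>i. \<integral>x. indicator (A i) x * V n x \<partial>lborel) \<longlonglongrightarrow> (\<Sum>i. 0)"
        using tannerys_theorem[where a = "\<lambda>i n. \<integral>x. indicator (A i) x * V n x \<partial>lborel" and M = ?m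
            and F = sequentially and b = "\<lambda>_. 0"] union(3)
        by (simp add: always_eventually case_prod_unfold)
      then show ?case using sm[OF V] by (simp add: sums_iff)
    qed
  qed
  have hV: "integrable lborel (\<lambda>x. g x * V n x)" if g: "integrable lborel g" for g n
  proof (rule Bochner_Integration.integrable_bound[OF integrable_mult_right[OF g, of B]])
    show "AE x in lborel. norm (g x * V n x) \<le> norm (B * g x)"
    proof (rule AE_I2)
      fix x
      have "\<bar>V n x\<bar> * \<bar>g x\<bar> \<le> \<bar>B\<bar> * \<bar>g x\<bar>"
        using VB[of n x] by (intro mult_right_mono) auto
      then show "norm (g x * V n x) \<le> norm (B * g x)" by (simp add: abs_mult mult.commute)
    qed
  qed (use g in \<open>auto dest: borel_measurable_integrable\<close>)
  show ?thesis using h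
  proof (induction rule: integrable_induct)
    case (base A c)
    then show ?case using tendsto_mult_left[OF indi[of A], of c]
      by (simp add: ac_simps flip: integral_mult_right_zero)
  next
    case (add f g)
    then show ?case using tendsto_add[OF add.IH] add.hyps
      by (simp add: distrib_right hV)
  next
    case (lim f s)
    have s: "\<And>i. integrable lborel (s i)" and f: "integrable lborel f"
      and conv: "\<And>x. (\<lambda>i. s i x) \<longlonglongrightarrow> f x" and dom: "\<And>i x. \<bar>s i x\<bar> \<le> 2 * \<bar>f x\<bar>"
      and IH: "\<And>i. (\<lambda>n. \<integral>x. s i x * V n x \<partial>lborel) \<longlonglongrightarrow> 0"
      using lim by auto
    note [measurable] = borel_measurable_integrable[OF s] borel_measurable_integrable[OF f]
    have "(\<lambda>i. \<integral>x. norm (s i x - f x) \<partial>lborel) \<longlonglongrightarrow> (\<integral>x. 0 \<partial>(lborel::real measure))"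
    proof (rule integral_dominated_convergence[where w = "\<lambda>x. 3 * norm (f x)"])
      show "AE x in lborel. (\<lambda>i. norm (s i x - f x)) \<longlonglongrightarrow> 0"
        using conv by (intro AE_I2 tendsto_norm_zero) (simp add: LIM_zero_iff)
      show "AE x in lborel. norm (norm (s i x - f x)) \<le> 3 * norm (f x)" for i
        using dom[of i] by (intro AE_I2) (smt (verit) real_norm_def)
    qed (use f in auto)
    then have sf: "(\<lambda>i. \<integral>x. norm (s i x - f x) \<partial>lborel) \<longlonglongrightarrow> 0" by simp
    have B0: "0 \<le> B" using VB[of 0 0] by linarith
    have approx: "\<bar>(\<integral>x. f x * V n x \<partial>lborel) - (\<integral>x. s i x * V n x \<partial>lborel)\<bar>
        \<le> B * (\<integral>x. norm (s i x - f x) \<partial>lborel)" for i n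
    proof -
      have "\<bar>(\<integral>x. f x * V n x \<partial>lborel) - (\<integral>x. s i x * V n x \<partial>lborel)\<bar>
         = norm (\<integral>x. (f x - s i x) * V n x \<partial>lborel)"
        using hV[OF f] hV[OF s] by (simp add: left_diff_distrib)
      also have "\<dots> \<le> (\<integral>x. B * norm (s i x - f x) \<partial>lborel)"
      proof (rule Bochner_Integration.integral_norm_bound_integral)
        show "integrable lborel (\<lambda>x. (f x - s i x) * V n x)"
          using hV[OF f] hV[OF s] by (simp add: left_diff_distrib)
        show "integrable lborel (\<lambda>x. B * norm (s i x - f x))"
          using s f by auto
        show "norm ((f x - s i x) * V n x) \<le> B * norm (s i x - f x)" for x
          using mult_right_mono[OF VB[of n x], of "\<bar>s i x - f x\<bar>"]
          by (simp add: abs_mult abs_minus_commute mult.commute)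
      qed
      finally show ?thesis by simp
    qed
    show ?case
    proof (rule LIMSEQ_I)
      fix e :: real assume "0 < e"
      then have "eventually (\<lambda>i. (\<integral>x. norm (s i x - f x) \<partial>lborel) < e / (2 * (B + 1))) sequentially"
        using order_tendstoD(2)[OF sf, of "e / (2 * (B + 1))"] B0 by simp
      then obtain i where i: "(\<integral>x. norm (s i x - f x) \<partial>lborel) < e / (2 * (B + 1))"
        by (auto simp: eventually_sequentially)
      have "B * (\<integral>x. norm (s i x - f x) \<partial>lborel) \<le> B * (e / (2 * (B + 1)))"
        using i B0 by (intro mult_left_mono) auto
      also have "\<dots> \<le> e / 2" using B0 \<open>0 < e\<close> by (simp add: field_simps)
      finally have i2: "B * (\<integral>x. norm (s i x - f x) \<partial>lborel) \<le> e / 2" .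
      obtain N where "\<And>n. n \<ge> N \<Longrightarrow> \<bar>\<integral>x. s i x * V n x \<partial>lborel\<bar> < e / 2"
        using LIMSEQ_D[OF IH[of i], of "e/2"] \<open>0 < e\<close> by auto
      moreover have "norm ((\<integral>x. f x * V n x \<partial>lborel) - 0) < e"
        if "\<bar>\<integral>x. s i x * V n x \<partial>lborel\<bar> < e / 2" for n
        using approx[of n i] i2 that by (simp add: abs_if split: if_splits)
      ultimately show "\<exists>N. \<forall>n\<ge>N. norm ((\<integral>x. f x * V n x \<partial>lborel) - 0) < e" by blast
    qed
  qed
qed

lemma space_unit_borel_measure: "sets M = sets unit_borel \<Longrightarrow> space M = {0..1::real}"
  by (drule sets_eq_imp_space_eq) (simp add: space_restrict_space)

lemma continuous_on_measurable_unit_borel: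
  fixes f :: "real \<Rightarrow> real"
  assumes "sets M = sets unit_borel" "continuous_on {0..1} f"
  shows "f \<in> borel_measurable M"
  using borel_measurable_continuous_on_restrict[OF assms(2)] assms(1)
  by (simp cong: measurable_cong_sets)

lemma continuous_on_unit_bounded:
  fixes f :: "real \<Rightarrow> real"
  assumes "continuous_on {0..1} f"
  obtains B where "B \<ge> 0" "\<And>x. x \<in> {0..1} \<Longrightarrow> \<bar>f x\<bar> \<le> B"
proof -
  have "bounded (f ` {0..1})"
    using compact_continuous_image[OF assms] by (auto intro: compact_imp_bounded)
  then obtain B where "\<And>x. x \<in> {0..1} \<Longrightarrow> \<bar>f x\<bar> \<le> B"
    unfolding bounded_iff real_norm_def by blast
  then show ?thesis using that[of "max 0 B"] by force
qed

lemma continuous_on_integrable_unit_borel: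
  fixes f :: "real \<Rightarrow> real"
  assumes "prob_space M" "sets M = sets unit_borel" "continuous_on {0..1} f"
  shows "integrable M f"
proof -
  interpret prob_space M by fact
  obtain B where "\<And>x. x \<in> {0..1} \<Longrightarrow> \<bar>f x\<bar> \<le> B"
    using continuous_on_unit_bounded[OF assms(3)] by blast
  then show ?thesis
    using continuous_on_measurable_unit_borel[OF assms(2,3)] space_unit_borel_measure[OF assms(2)]
    by (intro integrable_const_bound[of _ B] AE_I2) auto
qed

text \<open>
  This is the only place where absolute continuity of the invariant measure enters. Other invariant
  measures, such as those on periodic orbits, do not satisfy the conclusion.
\<close>

lemma vanishing_primitives_imp_vanishing_integrals:
  fixes v :: "nat \<Rightarrow> real \<Rightarrow> real"
  assumes M: "prob_space M" "sets M = sets unit_borel"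
      "absolutely_continuous (restrict_space lborel {0..1}) M"
    and cont: "\<And>n. continuous_on {0..1} (v n)"
    and bound: "\<And>n x. x \<in> {0..1} \<Longrightarrow> \<bar>v n x\<bar> \<le> B"
    and avg: "\<And>t. t \<in> {0..1} \<Longrightarrow> (\<lambda>n. integral {0..t} (v n)) \<longlonglongrightarrow> 0"
  shows "(\<lambda>n. \<integral>x. v n x \<partial>M) \<longlonglongrightarrow> 0"
proof -
  interpret M: prob_space M by (rule M)
  have sp: "space M = {0..1}" using M(2) by (rule space_unit_borel_measure)
  have id: "(\<lambda>x. x) \<in> borel_measurable M"
    by (rule continuous_on_measurable_unit_borel[OF M(2)]) (rule continuous_on_id)
  \<comment> \<open>Pushing the measure forward to the whole line gives a density with respect to \<open>lborel\<close>.\<close>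
  define M' where "M' = distr M borel (\<lambda>x. x)"
  have M'sets: "sets M' = sets lborel" by (simp add: M'_def)
  have fin: "finite_measure M'"
    unfolding M'_def using M.finite_measure_distr[OF id] .
  have ac: "absolutely_continuous lborel M'"
    unfolding absolutely_continuous_def
  proof
    fix A :: "real set" assume A: "A \<in> null_sets lborel"
    then have Ab: "A \<in> sets borel" by auto
    have "A \<inter> {0..1} \<in> null_sets (restrict_space lborel {0..1})"
      using A by (subst null_sets_restrict_space) (auto intro: null_set_Int2)
    then have "A \<inter> {0..1} \<in> null_sets M"
      using M(3) by (auto simp: absolutely_continuous_def)
    then show "A \<in> null_sets M'"
      using Ab sp id by (auto simp: null_sets_def M'_def emeasure_distr)
  qed
  obtain h where hm: "h \<in> borel_measurable lborel"
    and h: "AE x in lborel. RN_deriv lborel M' x = ennreal (h x)" and h0: "\<And>x. 0 \<le> h x"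
    using sigma_finite_measure.real_RN_deriv[OF lborel.sigma_finite_measure_axioms fin ac M'sets] by blast
  have dens: "M' = density lborel (\<lambda>x. ennreal (h x))"
    using sigma_finite_measure.density_RN_deriv[OF lborel.sigma_finite_measure_axioms ac M'sets] h hm
    by (subst density_cong[of _ _ "RN_deriv lborel M'"]) (auto elim: eventually_mono)
  define V where "V = (\<lambda>n x. indicator {0..1} x * v n x)"
  have Vm: "V n \<in> borel_measurable borel" for n
    using borel_measurable_continuous_on_indicator[OF _ cont[of n]] by (simp add: V_def)
  have Vi: "integrable lborel (V n)" for n
    using borel_integrable_compact[OF _ cont[of n]] by (simp add: V_def indicator_def if_distrib cong: if_cong)
  have "integrable M' (\<lambda>x. 1 :: real)" using fin by (simp add: finite_measure.integrable_const)
  then have hint: "integrable lborel h"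
    unfolding dens using hm h0 by (subst (asm) integrable_real_density) auto
  have "(\<lambda>n. \<integral>x. h x * V n x \<partial>lborel) \<longlonglongrightarrow> 0"
  proof (rule integral_times_vanishing_averages[OF Vi _ _ hint, where B = B])
    show "\<bar>V n x\<bar> \<le> B * indicator {0..1} x" for n x
      using bound[of x n] by (auto simp: V_def indicator_def)
    show "(\<lambda>n. \<integral>x. indicator {..t} x * V n x \<partial>lborel) \<longlonglongrightarrow> 0" for t
    proof -
      have eq: "(\<integral>x. indicator {..t} x * V n x \<partial>lborel) = integral {0..min 1 t} (v n)" for n
      proof -
        have c: "continuous_on {0..min 1 t} (v n)"
          by (rule continuous_on_subset[OF cont]) auto
        have "(\<integral>x. indicator {..t} x * V n x \<partial>lborel) = (LINT x:{0..min 1 t}|lborel. v n x)"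
          unfolding set_lebesgue_integral_def V_def
          by (rule Bochner_Integration.integral_cong) (auto simp: indicator_def)
        also have "\<dots> = integral {0..min 1 t} (v n)"
          by (rule set_borel_integral_eq_integral[OF borel_integrable_atLeastAtMost'[OF c]])
        finally show ?thesis .
      qed
      show ?thesis
      proof (cases "0 \<le> t")
        case True
        then show ?thesis unfolding eq using avg[of "min 1 t"] by simp
      next
        case False
        then show ?thesis unfolding eq by simp
      qed
    qed
  qed
  moreover have "(\<integral>x. v n x \<partial>M) = (\<integral>x. h x * V n x \<partial>lborel)" for n
  proof -
    have "(\<integral>x. v n x \<partial>M) = (\<integral>x. V n x \<partial>M)"
      by (rule Bochner_Integration.integral_cong) (auto simp: V_def sp)
    also have "\<dots> = (\<integral>x. V n x \<partial>M')"
      unfolding M'_def using Vm[of n] by (simp add: integral_distr[OF id])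
    also have "\<dots> = (\<integral>x. h x * V n x \<partial>lborel)"
      unfolding dens using Vm[of n] hm h0 by (subst integral_real_density) auto
    finally show ?thesis .
  qed
  ultimately show ?thesis by simp
qed

section \<open>Primitives of continuous functions\<close>

definition prim :: "(real \<Rightarrow> real) \<Rightarrow> real \<Rightarrow> real" where
  "prim u t = integral {0..t} u"

lemma prim_0 [simp]: "prim u 0 = 0"
  by (simp add: prim_def)

lemma prim_has_real_derivative:
  assumes "continuous_on {0..1} u" "x \<in> {0..1}"
  shows "(prim u has_real_derivative u x) (at x within {0..1})"
  using integral_has_vector_derivative[OF assms]
  by (simp add: prim_def[abs_def] has_real_derivative_iff_has_vector_derivative)

lemma continuous_on_prim: "continuous_on {0..1} u \<Longrightarrow> continuous_on {0..1} (prim u)"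
  by (rule DERIV_continuous_on) (rule prim_has_real_derivative)

lemma integrable_on_subinterval_unit:
  fixes u :: "real \<Rightarrow> real"
  assumes "continuous_on {0..1} u" "0 \<le> s" "t \<le> 1"
  shows "u integrable_on {s..t}"
  by (rule integrable_continuous_real, rule continuous_on_subset[OF assms(1)]) (use assms in auto)

lemma prim_diff:
  assumes "continuous_on {0..1} u" "0 \<le> s" "s \<le> t" "t \<le> 1"
  shows "prim u t - prim u s = integral {s..t} u"
  using Henstock_Kurzweil_Integration.integral_combine[OF assms(2,3), of u]
    integrable_on_subinterval_unit[OF assms(1), of 0 t] assms
  by (simp add: prim_def)

lemma prim_lipschitz:
  assumes u: "continuous_on {0..1} u" and B: "\<And>x. x \<in> {0..1} \<Longrightarrow> \<bar>u x\<bar> \<le> B"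
    and st: "s \<in> {0..1}" "t \<in> {0..1}"
  shows "\<bar>prim u t - prim u s\<bar> \<le> B * \<bar>t - s\<bar>"
proof -
  have *: "\<bar>prim u t - prim u s\<bar> \<le> B * (t - s)" if "s \<le> t" "s \<in> {0..1}" "t \<in> {0..1}" for s t
  proof -
    have "continuous_on {s..t} u" by (rule continuous_on_subset[OF u]) (use that in auto)
    then show ?thesis
      using integral_bound[of s t u B] that B prim_diff[OF u, of s t] by (auto simp: abs_minus_commute)
  qed
  show ?thesis using *[of s t] *[of t s] st by (cases "s \<le> t") (auto simp: abs_minus_commute)
qed

lemma prim_diff_fun:
  assumes "continuous_on {0..1} u" "continuous_on {0..1} v" "t \<in> {0..1}"
  shows "prim (\<lambda>x. u x - v x) t = prim u t - prim v t"
  unfolding prim_def using assms by (intro Henstock_Kurzweil_Integration.integral_diff integrable_on_subinterval_unit) auto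

lemma prim_cmult: "prim (\<lambda>x. k * u x) t = k * prim u t"
  by (simp add: prim_def)

lemma prim_const: "t \<ge> 0 \<Longrightarrow> prim (\<lambda>x. k) t = k * t"
  by (simp add: prim_def)

lemma integral_affine_comp:
  assumes u: "continuous_on {0..1} u" and m: "m \<noteq> 0" and lt: "l \<le> t"
    and rng: "\<And>x. x \<in> {l..t} \<Longrightarrow> m * x + b \<in> {0..1}"
    and f: "\<And>x. x \<in> {l..t} \<Longrightarrow> f x = m * x + b"
  shows "integral {l..t} (\<lambda>x. u (f x)) = (prim u (f t) - prim u (f l)) / m"
proof -
  have "((\<lambda>x. u (m * x + b)) has_integral (prim u (m * t + b) / m - prim u (m * l + b) / m)) {l..t}"
  proof (rule fundamental_theorem_of_calculus[OF lt])
    fix x assume x: "x \<in> {l..t}"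
    have "(prim u has_real_derivative u (m * x + b)) (at (m * x + b) within (\<lambda>x. m * x + b) ` {l..t})"
      by (rule has_field_derivative_subset[OF prim_has_real_derivative[OF u rng[OF x]]]) (use rng in auto)
    moreover have "((\<lambda>x. m * x + b) has_real_derivative m) (at x within {l..t})"
      by (auto intro!: derivative_eq_intros)
    ultimately have "(prim u \<circ> (\<lambda>x. m * x + b) has_real_derivative u (m * x + b) * m) (at x within {l..t})"
      by (rule DERIV_image_chain)
    from DERIV_cdivide[OF this, of m] m
    show "((\<lambda>x. prim u (m * x + b) / m) has_vector_derivative u (m * x + b)) (at x within {l..t})"
      by (simp add: has_real_derivative_iff_has_vector_derivative o_def)
  qed
  then have "((\<lambda>x. u (f x)) has_integral (prim u (m * t + b) / m - prim u (m * l + b) / m)) {l..t}"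
    by (rule has_integral_eq[rotated]) (simp add: f)
  then show ?thesis using f lt by (simp add: integral_unique diff_divide_distrib)
qed

section \<open>A single W-shaped map and its critical orbit\<close>

text \<open>
  The branches depend on \<open>a\<close> only through the two inner slopes and the turning value \<open>c\<close>. The
  hypotheses say that the two outer branches have positive length and that \<open>c\<close> lies in \<open>[1/2, 1)\<close>.
\<close>

locale w_map =
  fixes S1 S2 c :: real
  assumes S1: "2 * c < S1" and S2: "2 * c < S2" and c_lower: "1/2 \<le> c" and c_less_1: "c < 1"
begin

text \<open>
  The zeros \<open>c1\<close> and \<open>c2\<close> of the map separate the inner branches from the outer ones. As the outer
  branches map onto \<open>[0,1]\<close>, their inverse slopes are \<open>- c1\<close> and \<open>1 - c2\<close>. At a turning point
  \<open>inv_slope\<close> takes the value of the branch to the right, and \<open>jump\<close> is the amount by which it drops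
  at 1/2. The orbit starts at the turning value \<open>c\<close>, the image of 1/2.
\<close>

definition "c1 = 1/2 - c / S1"
definition "c2 = 1/2 + c / S2"
definition T :: "real \<Rightarrow> real" where
  "T x = (if x < c1 then 1 - x / c1 else if x < 1/2 then S1 * (x - 1/2) + c
     else if x < c2 then - S2 * (x - 1/2) + c else 1 + (x - 1) / (1 - c2))"
definition inv_slope :: "real \<Rightarrow> real" where
  "inv_slope x = (if x < c1 then - c1 else if x < 1/2 then 1 / S1
     else if x < c2 then - 1 / S2 else 1 - c2)"
definition "jump = 1 / S1 + 1 / S2"
definition "rho = max (1/2) (max (1 / S1) (1 / S2))"
definition right_half :: "real \<Rightarrow> real" where "right_half x = of_bool (1/2 \<le> x)"
definition orbit :: "nat \<Rightarrow> real" where "orbit k = (T ^^ k) c"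
definition weight :: "nat \<Rightarrow> real" where "weight k = (\<Prod>j<k. inv_slope (orbit j))"
definition orbit_sum :: "(real \<Rightarrow> real) \<Rightarrow> real" where "orbit_sum g = (\<Sum>k. weight k * g (orbit k))"

lemma S_gt_1: "1 < S1" "1 < S2" using S1 S2 c_lower by auto
lemma c_upper: "c \<le> 1" using c_less_1 by simp
lemma c_pos: "0 < c" using c_lower by linarith

lemma c1_bounds: "0 < c1" "c1 < 1/2"
  using S1 S_gt_1 c_pos by (auto simp: c1_def field_simps)
lemma c2_bounds: "1/2 < c2" "c2 < 1"
  using S2 S_gt_1 c_pos by (auto simp: c2_def field_simps)

lemma c2_minus_c1: "c2 - c1 = c * jump"
  by (simp add: c1_def c2_def jump_def field_simps)

lemma jump_pos: "0 < jump" using S_gt_1 by (simp add: jump_def add_pos_pos)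
lemma rho_bounds: "0 < rho" "rho < 1" using S_gt_1 by (auto simp: rho_def)

lemma abs_inv_slope_le: "\<bar>inv_slope x\<bar> \<le> rho"
  using c1_bounds c2_bounds S_gt_1 by (auto simp: inv_slope_def rho_def)

text \<open>
  The map is continuous, so each affine formula also holds at both end points of its piece.
\<close>

lemma T_on_pieces:
  "x \<le> c1 \<Longrightarrow> T x = (- 1 / c1) * x + 1"
  "c1 \<le> x \<Longrightarrow> x \<le> 1/2 \<Longrightarrow> T x = S1 * x + (c - S1 / 2)"
  "1/2 \<le> x \<Longrightarrow> x \<le> c2 \<Longrightarrow> T x = (- S2) * x + (c + S2 / 2)"
  "c2 \<le> x \<Longrightarrow> T x = (1 / (1 - c2)) * x + (- c2 / (1 - c2))"
proof -
  show "x \<le> c1 \<Longrightarrow> T x = (- 1 / c1) * x + 1"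
    using c1_bounds S_gt_1 by (cases "x = c1") (auto simp: T_def, simp add: c1_def field_simps)
  show "c1 \<le> x \<Longrightarrow> x \<le> 1/2 \<Longrightarrow> T x = S1 * x + (c - S1 / 2)"
    using c1_bounds c2_bounds by (cases "x = 1/2") (auto simp: T_def field_simps)
  show "1/2 \<le> x \<Longrightarrow> x \<le> c2 \<Longrightarrow> T x = (- S2) * x + (c + S2 / 2)"
    using c1_bounds c2_bounds S_gt_1 by (cases "x = c2") (auto simp: T_def field_simps, simp add: c2_def field_simps)
  show "c2 \<le> x \<Longrightarrow> T x = (1 / (1 - c2)) * x + (- c2 / (1 - c2))"
    using c1_bounds c2_bounds by (auto simp: T_def diff_divide_distrib[symmetric]) (simp add: field_simps)
qed

lemma S1_c1: "S1 * c1 = S1 / 2 - c" and S2_c2: "S2 * c2 = S2 / 2 + c"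
  using S_gt_1 by (auto simp: c1_def c2_def field_simps)

lemma affine_ranges:
  "0 \<le> x \<Longrightarrow> x \<le> c1 \<Longrightarrow> (- 1 / c1) * x + 1 \<in> {0..1}"
  "c1 \<le> x \<Longrightarrow> x \<le> 1/2 \<Longrightarrow> S1 * x + (c - S1 / 2) \<in> {0..c}"
  "1/2 \<le> x \<Longrightarrow> x \<le> c2 \<Longrightarrow> (- S2) * x + (c + S2 / 2) \<in> {0..c}"
  "c2 \<le> x \<Longrightarrow> x \<le> 1 \<Longrightarrow> (1 / (1 - c2)) * x + (- c2 / (1 - c2)) \<in> {0..1}"
proof -
  show "0 \<le> x \<Longrightarrow> x \<le> c1 \<Longrightarrow> (- 1 / c1) * x + 1 \<in> {0..1}"
    using c1_bounds by (auto simp: field_simps)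
  show "c1 \<le> x \<Longrightarrow> x \<le> 1/2 \<Longrightarrow> S1 * x + (c - S1 / 2) \<in> {0..c}"
    using S_gt_1 S1_c1 mult_left_mono[of c1 x S1] mult_left_mono[of x "1/2" S1] by auto
  show "1/2 \<le> x \<Longrightarrow> x \<le> c2 \<Longrightarrow> (- S2) * x + (c + S2 / 2) \<in> {0..c}"
    using S_gt_1 S2_c2 mult_left_mono[of x c2 S2] mult_left_mono[of "1/2" x S2] by auto
  show "c2 \<le> x \<Longrightarrow> x \<le> 1 \<Longrightarrow> (1 / (1 - c2)) * x + (- c2 / (1 - c2)) \<in> {0..1}"
    using c2_bounds by (auto simp: add_divide_distrib[symmetric] diff_divide_distrib[symmetric])
qed

lemma T_range:
  assumes "x \<in> {0..1}"
  shows "T x \<in> {0..1}"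
proof -
  have "{0..c} \<subseteq> {0..1}" using c_upper by auto
  then consider "x \<le> c1" | "c1 \<le> x" "x \<le> 1/2" | "1/2 \<le> x" "x \<le> c2" | "c2 \<le> x"
    by linarith
  then show ?thesis
    by cases (use assms \<open>{0..c} \<subseteq> {0..1}\<close> affine_ranges[of x] T_on_pieces[of x] in \<open>auto simp del: atLeastAtMost_iff\<close>, use assms in auto)
qed

lemma continuous_on_T: "continuous_on {0..1} T"
proof -
  have "continuous_on {..c1} T"
    by (rule continuous_on_cong[THEN iffD2, OF refl T_on_pieces(1)]) (use c1_bounds in \<open>auto intro!: continuous_intros\<close>)
  moreover have "continuous_on {c1..1/2} T"
    by (rule continuous_on_cong[THEN iffD2, OF refl T_on_pieces(2)]) (auto intro!: continuous_intros)
  moreover have "continuous_on {1/2..c2} T"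
    by (rule continuous_on_cong[THEN iffD2, OF refl T_on_pieces(3)]) (auto intro!: continuous_intros)
  moreover have "continuous_on {c2..} T"
    by (rule continuous_on_cong[THEN iffD2, OF refl T_on_pieces(4)]) (use c2_bounds in \<open>auto intro!: continuous_intros\<close>)
  ultimately have "continuous_on ((({..c1} \<union> {c1..1/2}) \<union> {1/2..c2}) \<union> {c2..}) T"
    by (intro continuous_on_closed_Un) auto
  then show ?thesis by (rule continuous_on_subset) auto
qed

lemma continuous_on_comp_T:
  "continuous_on {0..1} u \<Longrightarrow> continuous_on {0..1} (\<lambda>x. u (T x))"
  by (rule continuous_on_compose2[OF _ continuous_on_T]) (use T_range in blast)+

lemma T_values: "T 0 = 1" "T 1 = 1" "T c1 = 0" "T (1/2) = c" "T c2 = 0"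
proof -
  have "(c2 - 1) / (1 - c2) = - 1" using c2_bounds by (simp add: field_simps)
  then show "T 0 = 1" "T 1 = 1" "T c1 = 0" "T (1/2) = c" "T c2 = 0"
    using c1_bounds c2_bounds S1_c1 by (auto simp: T_def right_diff_distrib')
qed

text \<open>
  Composition with the map acts on primitives by composition and multiplication with the inverse
  slope, up to constants on each side of 1/2. At \<open>c1\<close> and \<open>c2\<close> no constant is picked up because the
  map takes the value 0 there, where primitives vanish. At 1/2 the inverse slope changes sign while
  the primitive has the value \<open>prim u c\<close>, and this is the only source of a discontinuity.
\<close>

lemma prim_comp_T:
  assumes u: "continuous_on {0..1} u" and t: "t \<in> {0..1}"
  shows "prim (\<lambda>x. u (T x)) t = inv_slope t * prim u (T t) + c1 * prim u 1 + jump * right_half t * prim u c"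
proof -
  let ?P = "prim (\<lambda>x. u (T x))"
  note cT = continuous_on_comp_T[OF u]
  have unit: "y \<in> {0..1}" if "y \<in> {0..c}" for y using that c_upper by auto
  have A1: "?P t = - c1 * prim u (T t) + c1 * prim u 1" if "0 \<le> t" "t \<le> c1" for t
  proof -
    have "integral {0..t} (\<lambda>x. u (T x)) = (prim u (T t) - prim u (T 0)) / (- 1 / c1)"
      by (rule integral_affine_comp[OF u, where b = 1]) (use that c1_bounds affine_ranges T_on_pieces in auto)
    then show ?thesis using c1_bounds by (simp add: prim_def[of "\<lambda>x. u (T x)"] T_values field_simps)
  qed
  have B1: "?P c1 = c1 * prim u 1" using A1[of c1] c1_bounds by (simp add: T_values)
  have A2: "?P t = c1 * prim u 1 + prim u (T t) / S1" if "c1 \<le> t" "t \<le> 1/2" for t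
  proof -
    have "integral {c1..t} (\<lambda>x. u (T x)) = (prim u (T t) - prim u (T c1)) / S1"
      by (rule integral_affine_comp[OF u, where b = "c - S1 / 2"])
        (use that S_gt_1 unit affine_ranges(2) T_on_pieces(2) in auto)
    then show ?thesis using prim_diff[OF cT, of c1 t] that c1_bounds by (simp add: T_values B1)
  qed
  have B2: "?P (1/2) = c1 * prim u 1 + prim u c / S1" using A2[of "1/2"] c1_bounds by (simp add: T_values)
  have A3: "?P t = c1 * prim u 1 + jump * prim u c - prim u (T t) / S2" if "1/2 \<le> t" "t \<le> c2" for t
  proof -
    have "integral {1/2..t} (\<lambda>x. u (T x)) = (prim u (T t) - prim u (T (1/2))) / (- S2)"
      by (rule integral_affine_comp[OF u, where b = "c + S2 / 2"])
        (use that S_gt_1 unit affine_ranges(3) T_on_pieces(3) in auto)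
    then show ?thesis using prim_diff[OF cT, of "1/2" t] that c2_bounds
      by (simp add: T_values B2 jump_def add_divide_distrib diff_divide_distrib algebra_simps)
  qed
  have B3: "?P c2 = c1 * prim u 1 + jump * prim u c" using A3[of c2] c2_bounds by (simp add: T_values)
  have A4: "?P t = c1 * prim u 1 + jump * prim u c + (1 - c2) * prim u (T t)" if "c2 \<le> t" "t \<le> 1" for t
  proof -
    have "integral {c2..t} (\<lambda>x. u (T x)) = (prim u (T t) - prim u (T c2)) / (1 / (1 - c2))"
      by (rule integral_affine_comp[OF u, where b = "- c2 / (1 - c2)"])
        (use that c2_bounds affine_ranges(4) T_on_pieces(4) in auto)
    then show ?thesis using prim_diff[OF cT, of c2 t] that c2_bounds
      by (simp add: T_values B3 field_simps)
  qed
  show ?thesis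
    using A1[of t] A2[of t] A3[of t] A4[of t] t c1_bounds c2_bounds by (auto simp: inv_slope_def right_half_def)
qed

lemma orbit_0: "orbit 0 = c" and orbit_Suc: "orbit (Suc k) = T (orbit k)"
  by (auto simp: orbit_def)
lemma orbit_range: "orbit k \<in> {0..1}"
  by (induction k) (use c_pos c_upper T_range in \<open>auto simp: orbit_0 orbit_Suc simp del: atLeastAtMost_iff\<close>, auto)
lemma weight_0: "weight 0 = 1" and weight_Suc: "weight (Suc k) = weight k * inv_slope (orbit k)"
  by (auto simp: weight_def)
lemma abs_weight_le: "\<bar>weight k\<bar> \<le> rho ^ k"
proof (induction k)
  case (Suc k)
  then show ?case using mult_mono[OF Suc abs_inv_slope_le[of "orbit k"]] rho_bounds by (simp add: weight_Suc abs_mult mult.commute)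
qed (simp add: weight_0)

lemma summable_rho: "summable (\<lambda>k. rho ^ k)" using rho_bounds by (simp add: summable_geometric)

lemma summable_abs_orbit_sum:
  assumes "\<And>x. x \<in> {0..1} \<Longrightarrow> \<bar>g x\<bar> \<le> B"
  shows "summable (\<lambda>k. \<bar>weight k * g (orbit k)\<bar>)"
proof (rule summable_comparison_test_ev)
  show "\<forall>\<^sub>F k in sequentially. norm \<bar>weight k * g (orbit k)\<bar> \<le> rho ^ k * B"
    using assms[OF orbit_range] rho_bounds by (intro always_eventually allI)
      (auto simp: abs_mult intro!: mult_mono abs_weight_le)
  show "summable (\<lambda>k. rho ^ k * B)" using summable_rho by (rule summable_mult2)
qed

lemma summable_orbit_sum:
  assumes "\<And>x. x \<in> {0..1} \<Longrightarrow> \<bar>g x\<bar> \<le> B"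
  shows "summable (\<lambda>k. weight k * g (orbit k))"
  using summable_abs_orbit_sum[OF assms] by (rule summable_rabs_cancel)

lemma abs_orbit_sum_le:
  assumes "\<And>x. x \<in> {0..1} \<Longrightarrow> \<bar>g x\<bar> \<le> B"
  shows "\<bar>orbit_sum g\<bar> \<le> B / (1 - rho)"
proof -
  have "\<bar>orbit_sum g\<bar> \<le> (\<Sum>k. \<bar>weight k * g (orbit k)\<bar>)"
    unfolding orbit_sum_def by (rule summable_rabs[OF summable_abs_orbit_sum[OF assms]])
  also have "\<dots> \<le> (\<Sum>k. rho ^ k * B)"
    using assms[OF orbit_range] summable_mult2[OF summable_rho] rho_bounds
    by (intro suminf_le summable_abs_orbit_sum[OF assms]) (auto simp: abs_mult intro!: mult_mono abs_weight_le)
  also have "\<dots> = B / (1 - rho)"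
    using rho_bounds suminf_mult2[OF summable_rho, of B] by (simp add: suminf_geometric)
  finally show ?thesis .
qed

lemma orbit_sum_add:
  assumes "\<And>x. x \<in> {0..1} \<Longrightarrow> \<bar>f x\<bar> \<le> A" "\<And>x. x \<in> {0..1} \<Longrightarrow> \<bar>g x\<bar> \<le> B"
  shows "orbit_sum (\<lambda>x. f x + g x) = orbit_sum f + orbit_sum g"
  unfolding orbit_sum_def using suminf_add[OF summable_orbit_sum[where g = f, OF assms(1)] summable_orbit_sum[where g = g, OF assms(2)]]
  by (simp add: distrib_left)

lemma orbit_sum_cmult:
  assumes "\<And>x. x \<in> {0..1} \<Longrightarrow> \<bar>f x\<bar> \<le> A"
  shows "orbit_sum (\<lambda>x. k * f x) = k * orbit_sum f"
  unfolding orbit_sum_def using suminf_mult[OF summable_orbit_sum[where g = f, OF assms], where c = k]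
  by (simp add: mult.left_commute)

lemma orbit_sum_cong: "(\<And>x. x \<in> {0..1} \<Longrightarrow> f x = g x) \<Longrightarrow> orbit_sum f = orbit_sum g"
  unfolding orbit_sum_def using orbit_range by simp

text \<open>
  On the orbit, the operator that multiplies a composition with the map by the inverse slope is a
  shift of the series, which loses exactly its first term. This makes \<open>orbit_sum\<close> telescope below.
\<close>

lemma orbit_sum_shift:
  assumes "\<And>x. x \<in> {0..1} \<Longrightarrow> \<bar>g x\<bar> \<le> B"
  shows "orbit_sum (\<lambda>x. inv_slope x * g (T x)) = orbit_sum g - g c"
  unfolding orbit_sum_def using suminf_split_initial_segment[OF summable_orbit_sum[where g = g, OF assms], where k = 1]
  by (simp add: weight_0 orbit_0 weight_Suc orbit_Suc mult.assoc)

section \<open>Integrals against an absolutely continuous invariant measure\<close>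

text \<open>
  The gap is one-sided. An orbit point equal to 1/2 is harmless, as \<open>right_half\<close> is continuous
  from the right.
\<close>

lemma gap_left_of_half:
  obtains d where "0 < d" "d \<le> 1/2" "\<And>k. k < N \<Longrightarrow> orbit k \<le> 1/2 - d \<or> 1/2 \<le> orbit k"
proof -
  have "\<exists>d>0. d \<le> 1/2 \<and> (\<forall>k<N. orbit k \<le> 1/2 - d \<or> 1/2 \<le> orbit k)"
  proof (induction N)
    case 0
    show ?case by (rule exI[of _ "1/2"]) auto
  next
    case (Suc N)
    then obtain d where d: "0 < d" "d \<le> 1/2" "\<forall>k<N. orbit k \<le> 1/2 - d \<or> 1/2 \<le> orbit k" by auto
    show ?case
    proof (cases "orbit N < 1/2")
      case True
      then show ?thesis using d
        by (intro exI[of _ "min d (1/2 - orbit N)"]) (force simp: less_Suc_eq min_def)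
    next
      case False
      then show ?thesis using d by (intro exI[of _ d]) (auto simp: less_Suc_eq)
    qed
  qed
  then show ?thesis using that by blast
qed

text \<open>
  A continuous function whose primitive is a smoothed step at 1/2 that agrees with the step at the
  first \<open>N\<close> orbit points. Subtracting a multiple of it from a test function repairs the jump that
  composition with the map creates, at an error seen only by the tail of the orbit sum.
\<close>

lemma smoothed_jump:
  obtains w where "continuous_on {0..1} w" "prim w 1 = 1"
    "\<And>x. x \<in> {0..1} \<Longrightarrow> prim w x \<in> {0..1}" "\<And>k. k < N \<Longrightarrow> prim w (orbit k) = right_half (orbit k)"
proof -
  obtain d where d: "0 < d" "d \<le> 1/2" and gap: "\<And>k. k < N \<Longrightarrow> orbit k \<le> 1/2 - d \<or> 1/2 \<le> orbit k"
    using gap_left_of_half by blast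
  define b where "b = (\<lambda>x::real. max 0 ((x - (1/2 - d)) * (1/2 - x)))"
  have b: "continuous_on {0..1} b" unfolding b_def by (intro continuous_intros)
  have b0: "0 \<le> b x" for x by (simp add: b_def)
  have b_out: "b x = 0" if "x \<le> 1/2 - d \<or> 1/2 \<le> x" for x
    using that d by (auto simp: b_def max_def mult_le_0_iff not_le zero_le_mult_iff mult_eq_0_iff)
  have int0: "prim b t - prim b s = 0" if "0 \<le> s" "s \<le> t" "t \<le> 1" "t \<le> 1/2 - d \<or> 1/2 \<le> s" for s t
  proof -
    have "integral {s..t} b = integral {s..t} (\<lambda>x. 0)"
      by (rule Henstock_Kurzweil_Integration.integral_cong) (use that b_out in force)
    then show ?thesis using prim_diff[OF b] that by simp
  qed
  have mono: "prim b s \<le> prim b t" if "0 \<le> s" "s \<le> t" "t \<le> 1" for s t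
    using prim_diff[OF b that] integral_nonneg[OF integrable_on_subinterval_unit[OF b that(1,3)]] b0 by simp
  have pos: "0 < prim b 1"
  proof -
    have "0 \<le> prim b 1" using mono[of 0 1] by simp
    moreover have "prim b 1 \<noteq> 0"
    proof
      assume "prim b 1 = 0"
      then have "\<forall>x\<in>{0..1}. b x = 0"
        using integral_eq_0_iff[of 0 1 b] b b0 by (simp add: prim_def)
      then have "b (1/2 - d/2) = 0" using d by auto
      then show False using d by (auto simp: b_def max_def split: if_splits)
    qed
    ultimately show ?thesis by simp
  qed
  define w where "w = (\<lambda>x. (1 / prim b 1) * b x)"
  have pw: "prim w t = prim b t / prim b 1" for t
    unfolding w_def prim_cmult by simp
  show ?thesis
  proof (rule that[of w])
    show "continuous_on {0..1} w" unfolding w_def by (intro continuous_intros b)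
    show "prim w 1 = 1" using pos by (simp add: pw)
    show "prim w x \<in> {0..1}" if "x \<in> {0..1}" for x
      using mono[of 0 x] mono[of x 1] that pos by (auto simp: pw)
    show "prim w (orbit k) = right_half (orbit k)" if "k < N" for k
      using gap[OF that] int0[of 0 "orbit k"] int0[of "orbit k" 1] orbit_range[of k] pos d by (auto simp: pw right_half_def)
  qed
qed

definition orbit_abs_sum :: "(real \<Rightarrow> real) \<Rightarrow> real" where "orbit_abs_sum g = (\<Sum>k. \<bar>weight k * g (orbit k)\<bar>)"

lemma integral_invariant:
  fixes u :: "real \<Rightarrow> real"
  assumes "acim T M" and u: "continuous_on {0..1} u"
  shows "(\<integral>x. u (T x) \<partial>M) = (\<integral>x. u x \<partial>M)"
proof -
  have M: "sets M = sets unit_borel" "T \<in> measurable M M" "distr M M T = M"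
    using assms(1) by (auto simp: acim_def)
  show ?thesis
    using integral_distr[OF M(2) continuous_on_measurable_unit_borel[OF M(1) u]] M(3) by simp
qed

text \<open>
  The integral of a mean-zero test function is determined, up to one constant of the measure, by
  the orbit sum of its primitive. Repeatedly compose \<open>u\<close> with the map, which does not change the
  integral, and subtract the multiple \<open>gam\<close> of \<open>w\<close> that restores mean zero. For \<open>G n\<close>, the primitive
  of the \<open>n\<close>-th function, this reads \<open>G (n+1) = inv_slope * (G n \<circ> T) + gam n * q\<close>, where the
  remaining discontinuity of the first summand is compensated by \<open>q\<close>. Since \<open>q\<close> is almost invisible on
  the orbit, the absolute orbit sum of \<open>G n\<close> decreases by at least half of \<open>\<bar>G n c\<bar>\<close> in each step,
  so the values \<open>G n c\<close> are summable. Then \<open>G n\<close> tends to 0 uniformly, the functions themselves stay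
  bounded, and their integrals tend to 0. Throughout, the integral minus \<open>C\<close> times the
  orbit sum is conserved.
\<close>

lemma integral_mean_zero:
  assumes acim: "acim T M"
  obtains C where "\<And>u. continuous_on {0..1} u \<Longrightarrow> prim u 1 = 0 \<Longrightarrow> (\<integral>x. u x \<partial>M) = C * orbit_sum (prim u)"
proof -
  have M: "prob_space M" "sets M = sets unit_borel" "absolutely_continuous (restrict_space lborel {0..1}) M"
    using acim by (auto simp: acim_def)
  have "(\<lambda>N. jump * (rho ^ N / (1 - rho))) \<longlonglongrightarrow> jump * (0 / (1 - rho))"
    using rho_bounds by (intro tendsto_intros LIMSEQ_realpow_zero) auto
  then have "\<forall>\<^sub>F N in sequentially. jump * (rho ^ N / (1 - rho)) < 1/2"
    by (rule order_tendstoD) simp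
  then obtain N where N: "jump * (rho ^ N / (1 - rho)) < 1/2"
    by (auto simp: eventually_sequentially)
  obtain w where w: "continuous_on {0..1} w" "prim w 1 = 1"
    and w01: "\<And>x. x \<in> {0..1} \<Longrightarrow> prim w x \<in> {0..1}" and wz: "\<And>k. k < N \<Longrightarrow> prim w (orbit k) = right_half (orbit k)"
    using smoothed_jump by blast
  define q where "q = (\<lambda>x. right_half x - prim w x)"
  have q1: "\<bar>q x\<bar> \<le> 1" if "x \<in> {0..1}" for x
    using w01[OF that] by (auto simp: q_def right_half_def)
  have abs_sum_q: "jump * orbit_abs_sum q \<le> 1/2"
  proof -
    note sq = summable_abs_orbit_sum[where g = q, OF q1]
    have "orbit_abs_sum q = (\<Sum>k. \<bar>weight (k + N) * q (orbit (k + N))\<bar>)"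
      unfolding orbit_abs_sum_def using suminf_split_initial_segment[OF sq, where k = N] by (simp add: q_def wz)
    also have "\<dots> \<le> (\<Sum>k. rho ^ k * rho ^ N)"
    proof (rule suminf_le)
      show "\<bar>weight (k + N) * q (orbit (k + N))\<bar> \<le> rho ^ k * rho ^ N" for k
        using mult_mono[OF abs_weight_le[of "k + N"] q1[OF orbit_range[of "k + N"]]] rho_bounds
        by (simp add: abs_mult power_add)
      show "summable (\<lambda>k. \<bar>weight (k + N) * q (orbit (k + N))\<bar>)" using summable_ignore_initial_segment[OF sq] .
      show "summable (\<lambda>k. rho ^ k * rho ^ N)" by (rule summable_mult2[OF summable_rho])
    qed
    also have "\<dots> = rho ^ N / (1 - rho)"
      using rho_bounds suminf_mult2[OF summable_rho, of "rho ^ N"] by (simp add: suminf_geometric)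
    finally have "jump * orbit_abs_sum q \<le> jump * (rho ^ N / (1 - rho))" using jump_pos by (intro mult_left_mono) auto
    then show ?thesis using N by linarith
  qed
  have "\<bar>orbit_sum q\<bar> \<le> orbit_abs_sum q"
    unfolding orbit_sum_def orbit_abs_sum_def by (rule summable_rabs[OF summable_abs_orbit_sum[where g = q, OF q1]])
  then have "jump * \<bar>orbit_sum q\<bar> \<le> 1/2" using abs_sum_q jump_pos mult_left_mono[of "\<bar>orbit_sum q\<bar>" "orbit_abs_sum q" jump] by linarith
  then have "\<bar>jump * orbit_sum q\<bar> \<le> 1/2" using jump_pos by (simp add: abs_mult)
  then have Q: "1 - jump * orbit_sum q > 0" by linarith
  obtain Bw where Bw: "0 \<le> Bw" "\<And>x. x \<in> {0..1} \<Longrightarrow> \<bar>w x\<bar> \<le> Bw"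
    using continuous_on_unit_bounded[OF w(1)] by blast
  define Cw where "Cw = (\<integral>x. w x \<partial>M)"
  \<comment> \<open>The value that makes \<open>const\<close> below hold: one step changes the integral by \<open>- gam n * Cw\<close> and the
    orbit sum by \<open>- gam n * (1 / jump - orbit_sum q)\<close>.\<close>
  define C where "C = jump * Cw / (1 - jump * orbit_sum q)"
  show ?thesis
  proof (rule that[of C])
    fix u :: "real \<Rightarrow> real"
    assume u: "continuous_on {0..1} u" and u1: "prim u 1 = 0"
    define us where "us = rec_nat u (\<lambda>_ v x. v (T x) - jump * prim v c * w x)"
    have us_0: "us 0 = u" by (simp add: us_def)
    have us_Suc: "us (Suc n) = (\<lambda>x. us n (T x) - jump * prim (us n) c * w x)" for n by (simp add: us_def)
    have us: "continuous_on {0..1} (us n)" for n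
      by (induction n) (auto simp: us_0 us_Suc u intro!: continuous_intros w continuous_on_comp_T)
    define G where "G = (\<lambda>n. prim (us n))"
    define gam where "gam = (\<lambda>n. jump * G n c)"
    have G_Suc': "G (Suc n) t = inv_slope t * G n (T t) + c1 * G n 1 + gam n * q t" if "t \<in> {0..1}" for n t
    proof -
      have "G (Suc n) t = prim (\<lambda>x. us n (T x)) t - prim (\<lambda>x. gam n * w x) t"
        unfolding G_def us_Suc using that us w
        by (subst prim_diff_fun) (auto intro!: continuous_intros continuous_on_comp_T simp: gam_def G_def)
      also have "\<dots> = inv_slope t * G n (T t) + c1 * G n 1 + gam n * q t"
        by (simp add: prim_comp_T[OF us that] prim_cmult G_def gam_def q_def right_diff_distrib)
      finally show ?thesis .
    qed
    have G1: "G n 1 = 0" for n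
    proof (induction n)
      case 0
      then show ?case by (simp add: G_def us_0 u1)
    next
      case (Suc n)
      then show ?case using w by (simp add: G_Suc' T_values q_def right_half_def)
    qed
    have G_Suc: "G (Suc n) t = inv_slope t * G n (T t) + gam n * q t" if "t \<in> {0..1}" for n t
      using G_Suc'[OF that] G1 by simp
    have "\<exists>B. \<forall>x\<in>{0..1}. \<bar>G n x\<bar> \<le> B" for n
      using continuous_on_unit_bounded[OF continuous_on_prim[OF us[of n]]] unfolding G_def by metis
    then obtain BG where BG: "\<And>n x. x \<in> {0..1} \<Longrightarrow> \<bar>G n x\<bar> \<le> BG n" by metis
    have cI: "c \<in> {0..1}" using c_pos c_upper by auto
    have BsG: "\<bar>inv_slope x * G n (T x)\<bar> \<le> BG n" if "x \<in> {0..1}" for n x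
      using mult_mono[OF abs_inv_slope_le BG[OF T_range[OF that]]] rho_bounds BG[OF that, of n]
        mult_left_le_one_le[of "BG n" rho] by (simp add: abs_mult) (smt (verit))
    have Bgq: "\<bar>gam n * q x\<bar> \<le> \<bar>gam n\<bar>" if "x \<in> {0..1}" for n x
      using mult_left_mono[OF q1[OF that], of "\<bar>gam n\<bar>"] by (simp add: abs_mult)
    have sum_step: "orbit_sum (G (Suc n)) = orbit_sum (G n) - G n c + gam n * orbit_sum q" for n
    proof -
      have "orbit_sum (G (Suc n)) = orbit_sum (\<lambda>x. inv_slope x * G n (T x) + gam n * q x)"
        by (rule orbit_sum_cong) (rule G_Suc)
      also have "\<dots> = orbit_sum (\<lambda>x. inv_slope x * G n (T x)) + orbit_sum (\<lambda>x. gam n * q x)"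
        by (rule orbit_sum_add[OF BsG Bgq])
      also have "orbit_sum (\<lambda>x. inv_slope x * G n (T x)) = orbit_sum (G n) - G n c"
        by (rule orbit_sum_shift[where g = "G n", OF BG])
      also have "orbit_sum (\<lambda>x. gam n * q x) = gam n * orbit_sum q"
        by (rule orbit_sum_cmult[where f = q, OF q1])
      finally show ?thesis .
    qed
    have abs_sum_step: "orbit_abs_sum (G (Suc n)) \<le> orbit_abs_sum (G n) - \<bar>G n c\<bar> / 2" for n
    proof -
      note s1 = summable_abs_orbit_sum[where g = "\<lambda>x. inv_slope x * G n (T x)", OF BsG]
      note s2 = summable_abs_orbit_sum[where g = "\<lambda>x. gam n * q x", OF Bgq]
      note sG = summable_abs_orbit_sum[where g = "G n", OF BG]
      have "orbit_abs_sum (G (Suc n)) \<le> (\<Sum>k. \<bar>weight k * (inv_slope (orbit k) * G n (T (orbit k)))\<bar> + \<bar>weight k * (gam n * q (orbit k))\<bar>)"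
        unfolding orbit_abs_sum_def
        by (rule suminf_le[OF _ summable_abs_orbit_sum[where g = "G (Suc n)", OF BG] summable_add[OF s1 s2]])
          (simp add: G_Suc[OF orbit_range] distrib_left abs_triangle_ineq)
      also have "\<dots> = (\<Sum>k. \<bar>weight k * (inv_slope (orbit k) * G n (T (orbit k)))\<bar>) + (\<Sum>k. \<bar>weight k * (gam n * q (orbit k))\<bar>)"
        by (rule suminf_add[OF s1 s2, symmetric])
      also have "(\<Sum>k. \<bar>weight k * (inv_slope (orbit k) * G n (T (orbit k)))\<bar>) = orbit_abs_sum (G n) - \<bar>G n c\<bar>"
        unfolding orbit_abs_sum_def using suminf_split_initial_segment[OF sG, where k = 1]
        by (simp add: weight_0 orbit_0 weight_Suc orbit_Suc mult.assoc)
      also have "(\<Sum>k. \<bar>weight k * (gam n * q (orbit k))\<bar>) = \<bar>gam n\<bar> * orbit_abs_sum q"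
        unfolding orbit_abs_sum_def using suminf_mult[OF summable_abs_orbit_sum[where g = q, OF q1], where c = "\<bar>gam n\<bar>"]
        by (simp add: abs_mult mult.left_commute)
      also have "\<bar>gam n\<bar> * orbit_abs_sum q \<le> \<bar>G n c\<bar> / 2"
        using mult_left_mono[OF abs_sum_q, of "\<bar>G n c\<bar>"] jump_pos by (simp add: gam_def abs_mult ac_simps)
      finally show ?thesis by simp
    qed
    have abs_sum_nonneg: "0 \<le> orbit_abs_sum (G n)" for n
      unfolding orbit_abs_sum_def by (rule suminf_nonneg[OF summable_abs_orbit_sum[where g = "G n", OF BG]]) auto
    define L where "L = 2 * orbit_abs_sum (G 0)"
    have sum_Gc: "(\<Sum>j<n. \<bar>G j c\<bar>) \<le> L" for n
    proof -
      have "(\<Sum>j<n. \<bar>G j c\<bar>) \<le> 2 * (orbit_abs_sum (G 0) - orbit_abs_sum (G n))"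
      proof (induction n)
        case (Suc n)
        then show ?case using abs_sum_step[of n] by simp
      qed simp
      then show ?thesis using abs_sum_nonneg[of n] by (simp add: L_def)
    qed
    \<comment> \<open>A majorant of the sup norm of \<open>G n\<close>; it is summable because \<open>rho < 1\<close> and the values \<open>G n c\<close> are
      summable.\<close>
    define m where "m = rec_nat (BG 0) (\<lambda>n y. rho * y + jump * \<bar>G n c\<bar>)"
    have m_0: "m 0 = BG 0" and m_Suc: "m (Suc n) = rho * m n + jump * \<bar>G n c\<bar>" for n by (auto simp: m_def)
    have Gm: "\<bar>G n x\<bar> \<le> m n" if "x \<in> {0..1}" for n x
      using that
    proof (induction n arbitrary: x)
      case 0
      then show ?case using BG by (simp add: m_0)
    next
      case (Suc n)
      have "\<bar>G (Suc n) x\<bar> \<le> \<bar>inv_slope x * G n (T x)\<bar> + \<bar>gam n * q x\<bar>"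
        using G_Suc[OF Suc.prems] abs_triangle_ineq by simp
      also have "\<bar>inv_slope x * G n (T x)\<bar> \<le> rho * m n"
        using mult_mono[OF abs_inv_slope_le Suc.IH[OF T_range[OF Suc.prems]]] rho_bounds by (simp add: abs_mult)
      also have "\<bar>gam n * q x\<bar> \<le> jump * \<bar>G n c\<bar>"
        using Bgq[OF Suc.prems, of n] jump_pos by (simp add: gam_def abs_mult)
      finally show ?case by (simp add: m_Suc)
    qed
    have m_nonneg: "0 \<le> m n" for n using Gm[OF cI, of n] by linarith
    define X where "X = (BG 0 + jump * L) / (1 - rho)"
    have X: "BG 0 + rho * X + jump * L = X" using rho_bounds by (simp add: X_def field_simps)
    have sum_m: "(\<Sum>j<n. m j) \<le> X" for n
    proof (induction n)
      case 0
      show ?case using m_nonneg[of 0] jump_pos sum_Gc[of 0] rho_bounds by (simp add: X_def m_0)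
    next
      case (Suc n)
      have "(\<Sum>j<Suc n. m j) = BG 0 + (\<Sum>j<n. m (Suc j))"
        by (subst sum.lessThan_Suc_shift) (simp add: m_0)
      also have "\<dots> = BG 0 + rho * (\<Sum>j<n. m j) + jump * (\<Sum>j<n. \<bar>G j c\<bar>)"
        by (simp add: m_Suc sum.distrib sum_distrib_left)
      also have "\<dots> \<le> BG 0 + rho * X + jump * L"
        using Suc.IH sum_Gc jump_pos rho_bounds by (intro add_mono mult_left_mono) auto
      finally show ?case using X by simp
    qed
    have m_lim: "m \<longlonglongrightarrow> 0"
      by (rule summable_LIMSEQ_zero[OF summableI_nonneg_bounded[OF m_nonneg sum_m]])
    obtain Bu where Bu: "\<And>x. x \<in> {0..1} \<Longrightarrow> \<bar>u x\<bar> \<le> Bu"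
      using continuous_on_unit_bounded[OF u] by blast
    have us_bound: "\<bar>us n x\<bar> \<le> Bu + jump * Bw * (\<Sum>j<n. \<bar>G j c\<bar>)" if "x \<in> {0..1}" for n x
      using that
    proof (induction n arbitrary: x)
      case 0
      then show ?case using Bu by (simp add: us_0)
    next
      case (Suc n)
      have "\<bar>us (Suc n) x\<bar> \<le> \<bar>us n (T x)\<bar> + jump * \<bar>G n c\<bar> * \<bar>w x\<bar>"
        using jump_pos by (simp add: us_Suc G_def order_trans[OF abs_triangle_ineq4] abs_mult)
      also have "jump * \<bar>G n c\<bar> * \<bar>w x\<bar> \<le> jump * \<bar>G n c\<bar> * Bw"
        using Bw(2)[OF Suc.prems] jump_pos by (intro mult_left_mono) auto
      finally show ?case using Suc.IH[OF T_range[OF Suc.prems]] by (simp add: algebra_simps)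
    qed
    have us_bound': "\<bar>us n x\<bar> \<le> Bu + jump * Bw * L" if "x \<in> {0..1}" for n x
    proof -
      have "jump * Bw * (\<Sum>j<n. \<bar>G j c\<bar>) \<le> jump * Bw * L"
        using sum_Gc[of n] jump_pos Bw(1) by (intro mult_left_mono) auto
      then show ?thesis using us_bound[OF that, of n] by linarith
    qed
    have int_lim: "(\<lambda>n. \<integral>x. us n x \<partial>M) \<longlonglongrightarrow> 0"
    proof (rule vanishing_primitives_imp_vanishing_integrals[OF M us us_bound'])
      fix t :: real assume t: "t \<in> {0..1}"
      show "(\<lambda>n. integral {0..t} (us n)) \<longlonglongrightarrow> 0"
        using Gm[OF t] by (intro Lim_null_comparison[OF _ m_lim] always_eventually allI) (simp add: G_def prim_def)
    qed
    have sum_lim: "(\<lambda>n. orbit_sum (G n)) \<longlonglongrightarrow> 0"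
    proof (rule Lim_null_comparison)
      show "\<forall>\<^sub>F n in sequentially. norm (orbit_sum (G n)) \<le> m n / (1 - rho)"
        using abs_orbit_sum_le[OF Gm] by (simp add: always_eventually)
      show "(\<lambda>n. m n / (1 - rho)) \<longlonglongrightarrow> 0" using tendsto_divide[OF m_lim tendsto_const] rho_bounds by force
    qed
    have int_step: "(\<integral>x. us (Suc n) x \<partial>M) = (\<integral>x. us n x \<partial>M) - gam n * Cw" for n
    proof -
      have "(\<integral>x. us (Suc n) x \<partial>M) = (\<integral>x. us n (T x) \<partial>M) - (\<integral>x. gam n * w x \<partial>M)"
        unfolding us_Suc gam_def G_def
        by (intro Bochner_Integration.integral_diff continuous_on_integrable_unit_borel[OF M(1,2)] continuous_intros us w continuous_on_comp_T)
      then show ?thesis by (simp add: integral_invariant[OF acim us] Cw_def)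
    qed
    have const: "(\<integral>x. us n x \<partial>M) - C * orbit_sum (G n) = (\<integral>x. u x \<partial>M) - C * orbit_sum (prim u)" for n
    proof (induction n)
      case 0
      show ?case by (simp add: G_def us_0)
    next
      case (Suc n)
      have "gam n * Cw = C * (G n c - gam n * orbit_sum q)"
        using Q jump_pos by (simp add: C_def gam_def field_simps)
      then show ?case using Suc.IH by (simp add: int_step sum_step algebra_simps)
    qed
    have "(\<lambda>n. (\<integral>x. us n x \<partial>M) - C * orbit_sum (G n)) \<longlonglongrightarrow> 0 - C * 0"
      by (intro tendsto_intros int_lim sum_lim)
    then show "(\<integral>x. u x \<partial>M) = C * orbit_sum (prim u)"
      unfolding const by (simp add: LIMSEQ_const_iff)
  qed
qed

lemma continuous_on_unit_bound_prim:
  assumes "continuous_on {0..1} f"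
  obtains B where "\<And>x. x \<in> {0..1} \<Longrightarrow> \<bar>prim f x\<bar> \<le> B"
  using continuous_on_unit_bounded[OF continuous_on_prim[OF assms]] by metis

lemma abs_right_half_le: "\<bar>right_half x\<bar> \<le> 1" by (simp add: right_half_def)

lemma orbit_sum_prim_comp_T:
  assumes f: "continuous_on {0..1} f"
  shows "orbit_sum (prim (\<lambda>x. f (T x))) =
    orbit_sum (prim f) - prim f c + c1 * prim f 1 * orbit_sum (\<lambda>_. 1) + jump * prim f c * orbit_sum right_half"
proof -
  obtain B where B: "\<And>x. x \<in> {0..1} \<Longrightarrow> \<bar>prim f x\<bar> \<le> B"
    using continuous_on_unit_bound_prim[OF f] by blast
  have b1: "\<bar>inv_slope x * prim f (T x)\<bar> \<le> B" if "x \<in> {0..1}" for x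
    using mult_mono[OF abs_inv_slope_le B[OF T_range[OF that]]] rho_bounds B[OF that]
      mult_left_le_one_le[of B rho] by (simp add: abs_mult) (smt (verit))
  have b2: "\<bar>k * 1\<bar> \<le> \<bar>k\<bar>" for k :: real by simp
  have b3: "\<bar>k * right_half x\<bar> \<le> \<bar>k\<bar>" for k x
    using abs_right_half_le[of x] by (simp add: abs_mult mult_left_le)
  have b12: "\<bar>inv_slope x * prim f (T x) + k * 1\<bar> \<le> B + \<bar>k\<bar>" if "x \<in> {0..1}" for k x
    using b1[OF that] b2[of k] by linarith
  have "orbit_sum (prim (\<lambda>x. f (T x))) =
      orbit_sum (\<lambda>x. (inv_slope x * prim f (T x) + (c1 * prim f 1) * 1) + (jump * prim f c) * right_half x)"
    by (rule orbit_sum_cong) (simp add: prim_comp_T[OF f] algebra_simps)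
  also have "\<dots> = orbit_sum (\<lambda>x. inv_slope x * prim f (T x)) + orbit_sum (\<lambda>x. (c1 * prim f 1) * 1) + orbit_sum (\<lambda>x. (jump * prim f c) * right_half x)"
    by (simp only: orbit_sum_add[OF b12 b3] orbit_sum_add[where g = "\<lambda>x. (c1 * prim f 1) * 1", OF b1 b2])
  also have "orbit_sum (\<lambda>x. inv_slope x * prim f (T x)) = orbit_sum (prim f) - prim f c"
    by (rule orbit_sum_shift[where g = "prim f", OF B])
  also have "orbit_sum (\<lambda>x. (c1 * prim f 1) * 1) = c1 * prim f 1 * orbit_sum (\<lambda>_. 1)"
    by (rule orbit_sum_cmult[where A = 1]) simp
  also have "orbit_sum (\<lambda>x. (jump * prim f c) * right_half x) = jump * prim f c * orbit_sum right_half"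
    by (rule orbit_sum_cmult[where A = 1]) (rule abs_right_half_le)
  finally show ?thesis .
qed

text \<open>
  A general test function is reduced to mean zero by subtracting a constant. Inserting \<open>f \<circ> T\<close> and \<open>f\<close>
  into the resulting formula, invariance becomes a linear identity in the two numbers \<open>prim f 1\<close> and
  \<open>prim f c\<close>, and both coefficients have to vanish.
\<close>

lemma acim_integral_formula:
  assumes acim: "acim T M"
  obtains A C where
    "\<And>f. continuous_on {0..1} f \<Longrightarrow> (\<integral>x. f x \<partial>M) = A * prim f 1 + C * orbit_sum (prim f)"
    "A * (c2 - c1) = C * (c1 * orbit_sum (\<lambda>_. 1))"
    "C * (1 - jump * orbit_sum right_half) = A * jump"
proof -
  obtain C where C: "\<And>u. continuous_on {0..1} u \<Longrightarrow> prim u 1 = 0 \<Longrightarrow> (\<integral>x. u x \<partial>M) = C * orbit_sum (prim u)"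
    using integral_mean_zero[OF acim] by blast
  have M: "prob_space M" "sets M = sets unit_borel" using acim by (auto simp: acim_def)
  interpret prob_space M by (rule M)
  define A where "A = 1 - C * orbit_sum (\<lambda>x. x)"
  have rep: "(\<integral>x. f x \<partial>M) = A * prim f 1 + C * orbit_sum (prim f)" if f: "continuous_on {0..1} f" for f
  proof -
    let ?k = "prim f 1"
    obtain B where B: "\<And>x. x \<in> {0..1} \<Longrightarrow> \<bar>prim f x\<bar> \<le> B"
      using continuous_on_unit_bound_prim[OF f] by blast
    have pr: "prim (\<lambda>x. f x - ?k) t = prim f t - ?k * t" if "t \<in> {0..1}" for t
      using that f by (subst prim_diff_fun) (auto simp: prim_const)
    have lin: "\<bar>- ?k * x\<bar> \<le> \<bar>?k\<bar>" if "x \<in> {0..1}" for x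
      using that by (simp add: abs_mult mult_left_le)
    have "orbit_sum (prim (\<lambda>x. f x - ?k)) = orbit_sum (\<lambda>x. prim f x + (- ?k) * x)"
      by (rule orbit_sum_cong) (simp add: pr)
    also have "\<dots> = orbit_sum (prim f) + orbit_sum (\<lambda>x. (- ?k) * x)"
      by (rule orbit_sum_add[where f = "prim f", OF B lin])
    also have "orbit_sum (\<lambda>x. (- ?k) * x) = (- ?k) * orbit_sum (\<lambda>x. x)"
      by (rule orbit_sum_cmult[where A = 1]) simp
    finally have L: "orbit_sum (prim (\<lambda>x. f x - ?k)) = orbit_sum (prim f) - ?k * orbit_sum (\<lambda>x. x)" by simp
    have "(\<integral>x. f x \<partial>M) - ?k = (\<integral>x. f x - ?k \<partial>M)"
      using continuous_on_integrable_unit_borel[OF M f] by (simp add: prob_space)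
    also have "\<dots> = C * orbit_sum (prim (\<lambda>x. f x - ?k))"
      by (rule C) (use f pr[of 1] in \<open>auto intro!: continuous_intros\<close>)
    finally show ?thesis unfolding L by (simp add: A_def algebra_simps)
  qed
  have rel: "prim f 1 * (A * (c2 - c1) - C * (c1 * orbit_sum (\<lambda>_. 1))) = prim f c * (A * jump - C * (1 - jump * orbit_sum right_half))"
    if f: "continuous_on {0..1} f" for f
  proof -
    have p1: "prim (\<lambda>x. f (T x)) 1 = (1 - c2) * prim f 1 + c1 * prim f 1 + jump * prim f c"
      using prim_comp_T[OF f, of 1] c1_bounds c2_bounds by (simp add: T_values inv_slope_def right_half_def)
    have "A * prim (\<lambda>x. f (T x)) 1 + C * orbit_sum (prim (\<lambda>x. f (T x))) = A * prim f 1 + C * orbit_sum (prim f)"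
      using integral_invariant[OF acim f] rep[OF f] rep[OF continuous_on_comp_T[OF f]] by simp
    then show ?thesis unfolding p1 orbit_sum_prim_comp_T[OF f] by (simp add: algebra_simps)
  qed
  have cI: "0 < c" "c \<le> 1" using c_pos c_upper by auto
  define X Y where "X = A * (c2 - c1) - C * (c1 * orbit_sum (\<lambda>_. 1))" and "Y = A * jump - C * (1 - jump * orbit_sum right_half)"
  have r1: "X = c * Y"
    using rel[of "\<lambda>_. 1"] cI by (simp add: X_def Y_def prim_const)
  show ?thesis
  proof (rule that[of A C])
    \<comment> \<open>The constant 1 and a function supported to the left of \<open>c\<close> have linearly independent pairs of
      values \<open>prim f 1\<close>, \<open>prim f c\<close>, because \<open>c < 1\<close>.\<close>
    let ?g = "\<lambda>x::real. max 0 (1/2 - x)"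
    have g: "continuous_on {0..1} ?g" by (intro continuous_intros)
    have pc: "prim ?g c = prim ?g 1"
    proof -
      have "integral {c..1} ?g = integral {c..1} (\<lambda>x. 0)"
        by (rule Henstock_Kurzweil_Integration.integral_cong) (use c_lower in auto)
      then show ?thesis using prim_diff[OF g, of c 1] cI by simp
    qed
    have "prim ?g 1 \<noteq> 0"
    proof
      assume "prim ?g 1 = 0"
      then have "\<forall>x\<in>{0..1}. ?g x = 0" using integral_eq_0_iff[of 0 1 ?g] g by (simp add: prim_def)
      then have "?g 0 = 0" by (rule bspec) simp
      then show False by simp
    qed
    then have "X = Y" using rel[OF g] unfolding pc by (simp add: X_def Y_def)
    then have "X = 0" "Y = 0" using r1 c_less_1 by (auto simp: algebra_simps)
    then show "A * (c2 - c1) = C * (c1 * orbit_sum (\<lambda>_. 1))" "C * (1 - jump * orbit_sum right_half) = A * jump"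
      by (auto simp: X_def Y_def)
  qed (rule rep)
qed

section \<open>The critical orbit: fixed, trapped or escaping\<close>

text \<open>
  The integral with respect to the invariant density scaled by \<open>1 / C\<close>, with \<open>A\<close> eliminated by means
  of the first relation.
\<close>

definition unnormalized :: "(real \<Rightarrow> real) \<Rightarrow> real" where
  "unnormalized f = c1 / (c2 - c1) * orbit_sum (\<lambda>_. 1) * prim f 1 + orbit_sum (prim f)"

lemma acim_integral_unnormalized:
  assumes acim: "acim T M" and f: "continuous_on {0..1} f"
  shows "(\<integral>x. f x \<partial>M) * unnormalized (\<lambda>_. 1) = unnormalized f"
proof -
  obtain A C where rep: "\<And>f. continuous_on {0..1} f \<Longrightarrow> (\<integral>x. f x \<partial>M) = A * prim f 1 + C * orbit_sum (prim f)"
    and rel: "A * (c2 - c1) = C * (c1 * orbit_sum (\<lambda>_. 1))"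
    using acim_integral_formula[OF acim] by blast
  interpret prob_space M using acim by (simp add: acim_def)
  have A: "A = C * (c1 / (c2 - c1) * orbit_sum (\<lambda>_. 1))" using rel c1_bounds c2_bounds by (simp add: field_simps)
  have *: "(\<integral>x. g x \<partial>M) = C * unnormalized g" if "continuous_on {0..1} g" for g
    unfolding rep[OF that] A unnormalized_def by (simp add: algebra_simps)
  show ?thesis using *[OF f] *[of "\<lambda>_. 1"] by (simp add: prob_space)
qed

lemma orbit_sum_at_fixed_turning_point:
  assumes "c = 1/2"
  shows "orbit_sum g = S2 / (S2 + 1) * g (1/2)"
proof -
  have Tc: "T c = c" using T_values(4) by (fold assms)
  have orbit: "orbit k = c" for k by (induction k) (auto simp: orbit_0 orbit_Suc Tc)
  have "1/2 \<le> c" "c < c2" using assms c2_bounds by auto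
  then have sgc: "inv_slope c = - 1 / S2" using c1_bounds by (auto simp: inv_slope_def)
  have weight: "weight k = (- 1 / S2) ^ k" for k by (induction k) (auto simp: weight_0 weight_Suc orbit sgc)
  have "orbit_sum g = (\<Sum>k. (- 1 / S2) ^ k * g c)" unfolding orbit_sum_def by (simp add: orbit weight)
  also have "\<dots> = (1 / (1 - (- 1 / S2))) * g c"
    using S_gt_1 by (subst suminf_mult2[symmetric]) (auto simp: suminf_geometric summable_geometric)
  also have "1 / (1 - (- 1 / S2)) = S2 / (S2 + 1)" using S_gt_1 by (simp add: field_simps)
  finally show ?thesis by (fold assms)
qed

text \<open>
  If \<open>1/S1 + 1/S2 \<ge> 1\<close>, the image of \<open>c\<close> does not lie to the left of the fixed point of the second
  branch, so the interval between \<open>c\<close> and its image is mapped into itself. The other two hypotheses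
  say that it is contained in the two inner branches.
\<close>

lemma orbit_trapped:
  assumes trap: "S1 * S2 \<le> S1 + S2" and right: "S2 * (c - 1/2) < c" and left: "c1 \<le> c - S2 * (c - 1/2)"
  shows "orbit k \<in> {c - S2 * (c - 1/2)..c}" and "inv_slope (orbit k) = 1 / S1 - jump * right_half (orbit k)"
proof -
  have cc2: "c < c2" using right S_gt_1 by (simp add: c2_def field_simps)
  show orbit: "orbit k \<in> {c - S2 * (c - 1/2)..c}"
  proof (induction k)
    case 0
    show ?case using S_gt_1 c_lower by (simp add: orbit_0)
  next
    case (Suc k)
    show ?case
    proof (cases "orbit k \<le> 1/2")
      case True
      then have T: "T (orbit k) = c + S1 * (orbit k - 1/2)"
        using T_on_pieces(2)[of "orbit k"] Suc left by (auto simp: algebra_simps)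
      have "S1 * (c - S2 * (c - 1/2) - 1/2) \<le> S1 * (orbit k - 1/2)"
        using Suc S_gt_1 by (intro mult_left_mono) auto
      moreover have "S1 * (c - S2 * (c - 1/2) - 1/2) = - (S1 * S2 - S1) * (c - 1/2)"
        by (simp add: field_simps)
      moreover have "(S1 * S2 - S1) * (c - 1/2) \<le> S2 * (c - 1/2)"
        using trap c_lower by (intro mult_right_mono) auto
      ultimately have "- (S2 * (c - 1/2)) \<le> S1 * (orbit k - 1/2)" by linarith
      moreover have "S1 * (orbit k - 1/2) \<le> 0" using True S_gt_1 by (simp add: mult_le_0_iff)
      ultimately show ?thesis by (simp add: orbit_Suc T)
    next
      case False
      then have T: "T (orbit k) = c - S2 * (orbit k - 1/2)"
        using T_on_pieces(3)[of "orbit k"] Suc cc2 by (auto simp: algebra_simps)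
      have "S2 * (orbit k - 1/2) \<le> S2 * (c - 1/2)" "0 \<le> S2 * (orbit k - 1/2)"
        using Suc S_gt_1 False by (auto intro!: mult_left_mono)
      then show ?thesis by (simp add: orbit_Suc T)
    qed
  qed
  show "inv_slope (orbit k) = 1 / S1 - jump * right_half (orbit k)"
    using orbit left cc2 by (auto simp: inv_slope_def right_half_def jump_def)
qed

text \<open>
  As the orbit stays in the two inner branches, the shift relation expresses \<open>1 - jump * orbit_sum right_half\<close>
  through the sum of the weights. The two relations for \<open>A\<close> and \<open>C\<close> then give
  \<open>A * (c - 1/2) = 0\<close>, hence \<open>A = 0\<close>, and the weights sum to 0. The primitive of a function
  vanishing on the trapping interval is constant along the orbit.
\<close>

lemma trapped_integral_eq_0:
  fixes f :: "real \<Rightarrow> real"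
  assumes acim: "acim T M" and c: "1/2 < c"
    and trap: "S1 * S2 \<le> S1 + S2" "S2 * (c - 1/2) < c" "c1 \<le> c - S2 * (c - 1/2)"
    and f: "continuous_on {0..1} f" and f0: "\<And>x. x \<in> {c - S2 * (c - 1/2)..c} \<Longrightarrow> f x = 0"
  shows "(\<integral>x. f x \<partial>M) = 0"
proof -
  let ?S = "orbit_sum (\<lambda>_. 1)"
  obtain A C where rep: "\<And>f. continuous_on {0..1} f \<Longrightarrow> (\<integral>x. f x \<partial>M) = A * prim f 1 + C * orbit_sum (prim f)"
    and r1: "A * (c2 - c1) = C * (c1 * ?S)" and r2: "C * (1 - jump * orbit_sum right_half) = A * jump"
    using acim_integral_formula[OF acim] by blast
  interpret prob_space M using acim by (simp add: acim_def)
  have "?S - 1 = orbit_sum (\<lambda>x. inv_slope x * 1)" using orbit_sum_shift[where g = "\<lambda>_. 1" and B = 1] by simp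
  also have "\<dots> = orbit_sum (\<lambda>x. (1 / S1) * 1 + (- jump) * right_half x)"
    unfolding orbit_sum_def using orbit_trapped(2)[OF trap] by simp
  also have "\<dots> = orbit_sum (\<lambda>x. (1 / S1) * 1) + orbit_sum (\<lambda>x. (- jump) * right_half x)"
    by (rule orbit_sum_add[where A = "1 / S1" and B = jump])
       (use S_gt_1 jump_pos abs_right_half_le in \<open>auto simp: abs_mult mult_left_le\<close>)
  also have "\<dots> = (1 / S1) * ?S + (- jump) * orbit_sum right_half"
    using orbit_sum_cmult[where f = "\<lambda>_. 1" and A = 1 and k = "1 / S1"] orbit_sum_cmult[where f = right_half and A = 1 and k = "- jump", OF abs_right_half_le]
    by simp
  finally have "1 - jump * orbit_sum right_half = ?S * (1 - 1 / S1)" by (simp add: algebra_simps)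
  then have r3: "C * ?S * (1 - 1 / S1) = A * jump" using r2 by (simp add: mult.assoc)
  have "A * (c * jump) * (1 - 1 / S1) = c1 * (C * ?S * (1 - 1 / S1))"
    using r1 unfolding c2_minus_c1 by (simp add: algebra_simps)
  then have "A * jump * (c * (1 - 1 / S1) - c1) = 0" unfolding r3 by (simp add: algebra_simps)
  moreover have "c * (1 - 1 / S1) - c1 = c - 1/2" by (simp add: c1_def algebra_simps)
  ultimately have A: "A = 0" using c jump_pos by simp
  then have "C * orbit_sum (prim (\<lambda>_. 1)) = 1" using rep[of "\<lambda>_. 1"] by (simp add: prob_space)
  then have "C \<noteq> 0" by auto
  then have S: "?S = 0" using r1 A c1_bounds by simp
  have "prim f (orbit k) = prim f c" for k
  proof -
    have "integral {orbit k..c} f = integral {orbit k..c} (\<lambda>_. 0)"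
      by (rule Henstock_Kurzweil_Integration.integral_cong) (use orbit_trapped(1)[OF trap, of k] f0 in auto)
    then show ?thesis using prim_diff[OF f, of "orbit k" c] orbit_trapped(1)[OF trap, of k] orbit_range[of k] c_upper by simp
  qed
  then have "orbit_sum (prim f) = orbit_sum (\<lambda>_. prim f c * 1)" unfolding orbit_sum_def by simp
  also have "\<dots> = prim f c * ?S" by (rule orbit_sum_cmult[where A = 1]) simp
  finally show ?thesis using rep[OF f] A S by simp
qed

text \<open>
  Along the second branch the distance to its fixed point \<open>y\<close> grows by the factor \<open>S1\<close> in each step
  while the weight shrinks by the same factor. Until the orbit leaves the branch, the \<open>k\<close>-th term
  differs from the one with \<open>orbit\<close> frozen at \<open>y\<close> by \<open>O(S1\<^bsup>-k\<^esup> min(1, S1\<^bsup>k\<^esup> e))\<close>. Exit happens only when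
  \<open>S1\<^bsup>k\<^esup> e\<close> exceeds \<open>d\<close>, and from then on all weights are small. Interpolating \<open>min(1, t) \<le> t\<^bsup>3/4\<^esup>\<close>
  turns both estimates into one geometric majorant with the factor \<open>e\<^bsup>3/4\<^esup>\<close> and spares counting the
  steps until exit. Any exponent between 1/2 and 1 would serve in the critical case. The fourth
  roots \<open>\<epsilon>\<close> of \<open>e\<close> and \<open>m\<close> of \<open>S1\<close> keep all powers integral.
\<close>

lemma escaping_orbit_sum:
  assumes c: "1/2 < c" "S2 * (c - 1/2) < c"
    and y: "y = 1/2 - (c - 1/2) / (S1 - 1)"
    and e: "(c - 1/2) * (S2 - 1 - 1 / (S1 - 1)) = \<epsilon> ^ 4" "0 \<le> \<epsilon>"
    and m: "S1 = m ^ 4" "1 < m" and tau: "rho \<le> \<tau>" "1 / m \<le> \<tau>" "\<tau> < 1"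
    and d: "0 < d" "d \<le> 1" "c1 + d \<le> y"
    and B: "\<And>x. x \<in> {0..1} \<Longrightarrow> \<bar>g x\<bar> \<le> B"
    and lip: "\<And>x. x \<in> {0..1} \<Longrightarrow> \<bar>g x - g y\<bar> \<le> B * \<bar>x - y\<bar>"
  shows "\<bar>orbit_sum g - (g c - S1 / (S2 * (S1 - 1)) * g y)\<bar> \<le> 2 * B / d * \<epsilon> ^ 3 / (1 - \<tau>)"
proof -
  have y_le: "y < 1/2" using c(1) S_gt_1 by (simp add: y)
  have y01: "y \<in> {0..1}" using y_le d c1_bounds by auto
  have B0: "0 \<le> B" using B[OF y01] by linarith
  have S1i: "1 / S1 \<le> \<tau>" using tau(1) by (simp add: rho_def)
  have tau0: "0 < \<tau>" using rho_bounds tau by linarith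
  have cc2: "c < c2" using c S_gt_1 by (simp add: c2_def field_simps)
  have fixpt: "S1 * (y - 1/2) + c = y" using S_gt_1 by (simp add: y field_simps)
  have sgc: "inv_slope c = - 1 / S2" using cc2 c_lower c1_bounds by (auto simp: inv_slope_def)
  have Tc: "T c = y - \<epsilon> ^ 4"
  proof -
    have "w * (S2 - 1 - 1 / (S1 - 1)) = w * S2 - w - w / (S1 - 1)" for w by (simp add: right_diff_distrib)
    moreover have "S2 * (c - 1/2) = S2 * c - S2 / 2" by (simp add: right_diff_distrib)
    ultimately have "T c = y - (c - 1/2) * (S2 - 1 - 1 / (S1 - 1))"
      using T_on_pieces(3)[of c] cc2 c_lower unfolding y by (simp add: mult.commute)
    then show ?thesis by (simp only: e(1))
  qed
  have cube: "x ^ 4 \<le> x ^ 3" if "0 \<le> x" "x ^ 4 \<le> 1" for x :: real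
    using that power_decreasing[of 3 4 x] power_le_one_iff[of x 4] by simp
  have cube': "1 \<le> 1 / d * x ^ 3" if "0 \<le> x" "d < x ^ 4" for x :: real
  proof (cases "x \<le> 1")
    case True
    then have "x ^ 4 \<le> x ^ 3" using that power_decreasing[of 3 4 x] by simp
    then show ?thesis using that d by (simp add: field_simps)
  next
    case False
    then have "1 \<le> x ^ 3" using one_le_power[of x 3] by simp
    then show ?thesis using d by (simp add: field_simps)
  qed
  have pw: "S1 ^ k * \<epsilon> ^ 4 = (m ^ k * \<epsilon>) ^ 4" "(m ^ k * \<epsilon>) ^ 3 / S1 ^ k = \<epsilon> ^ 3 * (1 / m) ^ k" for k
  proof -
    show "S1 ^ k * \<epsilon> ^ 4 = (m ^ k * \<epsilon>) ^ 4"
      by (simp add: m(1) power_mult_distrib mult.commute flip: power_mult)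
    have "S1 ^ k = (m ^ k) ^ 3 * m ^ k" by (simp add: m(1) mult.commute flip: power_mult power_add)
    then show "(m ^ k * \<epsilon>) ^ 3 / S1 ^ k = \<epsilon> ^ 3 * (1 / m) ^ k"
      using m(2) by (simp add: power_mult_distrib power_divide)
  qed
  have mk: "\<epsilon> ^ 3 * (1 / m) ^ k \<le> \<epsilon> ^ 3 * \<tau> ^ k" for k
    using tau m e(2) by (intro mult_left_mono power_mono) auto
  \<comment> \<open>Either the orbit has followed the second branch so far, or it has left it and both the
    weight and the corresponding frozen weight are already below the majorant.\<close>
  have dich: "orbit (Suc k) = y - S1 ^ k * \<epsilon> ^ 4 \<and> weight (Suc k) = - 1 / S2 / S1 ^ k \<or>
      \<bar>weight (Suc k)\<bar> \<le> 1 / d * \<epsilon> ^ 3 * \<tau> ^ k \<and> 1 / S1 ^ k \<le> 1 / d * \<epsilon> ^ 3 * \<tau> ^ k" for k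
  proof (induction k)
    case 0
    show ?case by (simp add: orbit_Suc orbit_0 weight_Suc weight_0 Tc sgc)
  next
    case (Suc k)
    have shrink: "\<bar>weight (Suc (Suc k))\<bar> \<le> \<tau> * X" if "\<bar>weight (Suc k)\<bar> \<le> X" for X
    proof -
      have "\<bar>weight (Suc (Suc k))\<bar> \<le> rho * \<bar>weight (Suc k)\<bar>"
        using mult_right_mono[OF abs_inv_slope_le[of "orbit (Suc k)"], of "\<bar>weight (Suc k)\<bar>"]
        by (simp add: weight_Suc[of "Suc k"] abs_mult mult.commute)
      also have "\<dots> \<le> \<tau> * X" using tau(1) tau0 that by (intro mult_mono) auto
      finally show ?thesis .
    qed
    have shrink': "1 / S1 ^ Suc k \<le> \<tau> * X" if "1 / S1 ^ k \<le> X" for X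
      using mult_mono[OF S1i that] tau0 S_gt_1 by simp
    from Suc show ?case
    proof
      assume a: "orbit (Suc k) = y - S1 ^ k * \<epsilon> ^ 4 \<and> weight (Suc k) = - 1 / S2 / S1 ^ k"
      show ?thesis
      proof (cases "S1 ^ k * \<epsilon> ^ 4 \<le> d")
        case True
        have pos: "0 \<le> S1 ^ k * \<epsilon> ^ 4" using S_gt_1 by simp
        have zr: "c1 \<le> orbit (Suc k)" "orbit (Suc k) < 1/2" using a True d pos y_le by auto
        have zs: "orbit (Suc (Suc k)) = y - S1 ^ Suc k * \<epsilon> ^ 4"
        proof -
          have "orbit (Suc (Suc k)) = S1 * (orbit (Suc k) - 1/2) + c"
            using T_on_pieces(2)[OF zr(1) less_imp_le[OF zr(2)]] by (simp add: orbit_Suc[of "Suc k"] algebra_simps)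
          also have "orbit (Suc k) = y - S1 ^ k * \<epsilon> ^ 4" using a by simp
          also have "S1 * (y - S1 ^ k * \<epsilon> ^ 4 - 1/2) + c = (S1 * (y - 1/2) + c) - S1 ^ Suc k * \<epsilon> ^ 4"
            by (simp add: algebra_simps)
          finally show ?thesis by (simp only: fixpt)
        qed
        have "inv_slope (orbit (Suc k)) = 1 / S1" using zr by (auto simp: inv_slope_def)
        then show ?thesis using zs a by (simp add: weight_Suc[of "Suc k"])
      next
        case False
        then have "d < (m ^ k * \<epsilon>) ^ 4" by (simp add: pw(1))
        then have "1 \<le> 1 / d * (m ^ k * \<epsilon>) ^ 3" using m e(2) by (intro cube') auto
        then have "1 / S1 ^ k \<le> 1 / d * (m ^ k * \<epsilon>) ^ 3 / S1 ^ k"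
          using S_gt_1 by (intro divide_right_mono) auto
        also have "\<dots> = 1 / d * (\<epsilon> ^ 3 * (1 / m) ^ k)" by (simp only: pw(2)[of k, symmetric] times_divide_eq_right)
        also have "\<dots> \<le> 1 / d * (\<epsilon> ^ 3 * \<tau> ^ k)" using d by (intro mult_left_mono[OF mk]) auto
        finally have b: "1 / S1 ^ k \<le> 1 / d * \<epsilon> ^ 3 * \<tau> ^ k" by simp
        have "\<bar>weight (Suc k)\<bar> = 1 / S2 * (1 / S1 ^ k)" using a S_gt_1 by simp
        also have "\<dots> \<le> 1 / S1 ^ k" using S_gt_1 by (intro mult_left_le_one_le) auto
        finally have "\<bar>weight (Suc k)\<bar> \<le> 1 / d * \<epsilon> ^ 3 * \<tau> ^ k" using b by simp
        from shrink[OF this] shrink'[OF b] show ?thesis by (simp add: ac_simps)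
      qed
    next
      assume b: "\<bar>weight (Suc k)\<bar> \<le> 1 / d * \<epsilon> ^ 3 * \<tau> ^ k \<and> 1 / S1 ^ k \<le> 1 / d * \<epsilon> ^ 3 * \<tau> ^ k"
      then show ?thesis using shrink[OF conjunct1[OF b]] shrink'[OF conjunct2[OF b]] by (simp add: ac_simps)
    qed
  qed
  have term_bound: "\<bar>weight (Suc k) * g (orbit (Suc k)) + 1 / S2 / S1 ^ k * g y\<bar> \<le> 2 * B / d * \<epsilon> ^ 3 * \<tau> ^ k" for k
    using dich[of k]
  proof
    assume a: "orbit (Suc k) = y - S1 ^ k * \<epsilon> ^ 4 \<and> weight (Suc k) = - 1 / S2 / S1 ^ k"
    have le1: "(m ^ k * \<epsilon>) ^ 4 \<le> 1" using a orbit_range[of "Suc k"] y_le by (simp add: pw(1))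
    have "\<bar>weight (Suc k) * g (orbit (Suc k)) + 1 / S2 / S1 ^ k * g y\<bar> = 1 / S2 * (\<bar>g (orbit (Suc k)) - g y\<bar> / S1 ^ k)"
      using a S_gt_1 by (simp add: abs_mult abs_minus_commute flip: diff_divide_distrib)
    also have "\<dots> \<le> \<bar>g (orbit (Suc k)) - g y\<bar> / S1 ^ k"
      using S_gt_1 by (intro mult_left_le_one_le) auto
    also have "\<dots> \<le> B * (m ^ k * \<epsilon>) ^ 4 / S1 ^ k"
      using lip[OF orbit_range[of "Suc k"]] a S_gt_1 by (intro divide_right_mono) (auto simp: pw(1))
    also have "\<dots> \<le> B * (m ^ k * \<epsilon>) ^ 3 / S1 ^ k"
      using cube[OF _ le1] B0 S_gt_1 m e(2) by (intro divide_right_mono mult_left_mono) auto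
    also have "\<dots> = B * (\<epsilon> ^ 3 * (1 / m) ^ k)" by (simp only: pw(2)[of k, symmetric] times_divide_eq_right)
    also have "\<dots> \<le> B * (\<epsilon> ^ 3 * \<tau> ^ k)" by (rule mult_left_mono[OF mk B0])
    also have "\<dots> \<le> 2 * B / d * (\<epsilon> ^ 3 * \<tau> ^ k)"
    proof (rule mult_right_mono)
      have "B * d \<le> B * 1" using d B0 by (intro mult_left_mono) auto
      then show "B \<le> 2 * B / d" using d B0 by (simp add: field_simps)
    qed (use e(2) tau0 in auto)
    finally show ?thesis by (simp add: mult.assoc)
  next
    assume b: "\<bar>weight (Suc k)\<bar> \<le> 1 / d * \<epsilon> ^ 3 * \<tau> ^ k \<and> 1 / S1 ^ k \<le> 1 / d * \<epsilon> ^ 3 * \<tau> ^ k"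
    let ?X = "1 / d * \<epsilon> ^ 3 * \<tau> ^ k"
    have X0: "0 \<le> ?X" using d e(2) tau0 by simp
    have "\<bar>weight (Suc k) * g (orbit (Suc k))\<bar> \<le> ?X * B"
      unfolding abs_mult using b B[OF orbit_range[of "Suc k"]] X0 by (intro mult_mono) auto
    moreover have "\<bar>1 / S2 / S1 ^ k * g y\<bar> \<le> ?X * B"
    proof -
      have "1 / S2 * (1 / S1 ^ k) \<le> 1 / S1 ^ k" using S_gt_1 by (intro mult_left_le_one_le) auto
      then have "\<bar>1 / S2 / S1 ^ k\<bar> \<le> ?X" using b S_gt_1 by simp
      then show ?thesis unfolding abs_mult[of "1 / S2 / S1 ^ k"] using B[OF y01] X0 by (intro mult_mono) auto
    qed
    ultimately have "\<bar>weight (Suc k) * g (orbit (Suc k)) + 1 / S2 / S1 ^ k * g y\<bar> \<le> ?X * B + ?X * B"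
      by (rule order_trans[OF abs_triangle_ineq add_mono])
    then show ?thesis by (simp add: ac_simps)
  qed
  \<comment> \<open>The frozen terms sum to the geometric series in the statement.\<close>
  have geo: "(\<lambda>k. 1 / S2 / S1 ^ k * g y) sums (S1 / (S2 * (S1 - 1)) * g y)"
  proof -
    have "(\<lambda>k. (1 / S1) ^ k) sums (1 / (1 - 1 / S1))" using S_gt_1 by (intro geometric_sums) auto
    from sums_mult2[OF sums_mult[OF this, of "1 / S2"], of "g y"] show ?thesis
      using S_gt_1 by (simp add: power_one_over field_simps)
  qed
  have tail: "(\<lambda>k. weight (Suc k) * g (orbit (Suc k))) sums (orbit_sum g - g c)"
    using summable_sums[OF summable_orbit_sum[where g = g, OF B]] unfolding orbit_sum_def[symmetric]
    by (subst sums_Suc_iff) (simp add: weight_0 orbit_0)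
  have tot: "(\<lambda>k. weight (Suc k) * g (orbit (Suc k)) + 1 / S2 / S1 ^ k * g y) sums (orbit_sum g - g c + S1 / (S2 * (S1 - 1)) * g y)"
    by (rule sums_add[OF tail geo])
  have maj: "(\<lambda>k. 2 * B / d * \<epsilon> ^ 3 * \<tau> ^ k) sums (2 * B / d * \<epsilon> ^ 3 * (1 / (1 - \<tau>)))"
    using tau0 tau by (intro sums_mult geometric_sums) auto
  have "\<bar>orbit_sum g - g c + S1 / (S2 * (S1 - 1)) * g y\<bar> \<le> 2 * B / d * \<epsilon> ^ 3 * (1 / (1 - \<tau>))"
    using norm_suminf_le[OF _ sums_summable[OF maj], of "\<lambda>k. weight (Suc k) * g (orbit (Suc k)) + 1 / S2 / S1 ^ k * g y"]
      term_bound unfolding sums_unique[OF tot, symmetric] sums_unique[OF maj, symmetric] by simp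
  then show ?thesis by (simp add: algebra_simps)
qed

end

section \<open>The family of W-shaped maps near parameter zero\<close>

locale w_family =
  fixes s1 s2 p q r :: real
  assumes s1: "1 < s1" and s2: "1 < s2" and p: "0 < p" and q: "0 < q" and r: "0 < r"
begin

definition "left_slope a = s1 + p * a"
definition "right_slope a = s2 + q * a"
definition "peak a = 1/2 + r * a"
abbreviation "good a \<equiv> w_map (left_slope a) (right_slope a) (peak a)"
abbreviation "orbit_sum_at a \<equiv> w_map.orbit_sum (left_slope a) (right_slope a) (peak a)"

lemma tendsto_left_slope: "(left_slope \<longlongrightarrow> s1) (at_right 0)"
  and tendsto_right_slope: "(right_slope \<longlongrightarrow> s2) (at_right 0)"
  and tendsto_peak: "(peak \<longlongrightarrow> 1/2) (at_right 0)"
  unfolding left_slope_def[abs_def] right_slope_def[abs_def] peak_def[abs_def] by (auto intro!: tendsto_eq_intros)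

lemma pos: "\<forall>\<^sub>F a in at_right (0::real). 0 < a"
  by (auto simp: eventually_at_filter)

text \<open>
  The value of \<open>c1 / (c2 - c1)\<close> at \<open>a = 0\<close>: the ratio of \<open>A\<close> to \<open>C\<close> times the sum of the weights.
\<close>

lemma branch_ratio_0:
  "(1/2 - (1/2) / s1) / ((1/2) / s2 + (1/2) / s1) = s2 * (s1 - 1) / (s1 + s2)"
proof -
  have "1/2 - (1/2) / s1 = (s1 - 1) / (2 * s1)" using s1 by (simp add: field_simps)
  moreover have "(1/2) / s2 + (1/2) / s1 = (s1 + s2) / (2 * s1 * s2)" using s1 s2 by (simp add: field_simps)
  ultimately show ?thesis using s1 s2 by (simp add: divide_divide_eq_left)
qed

lemma good_0: "good 0"
  using s1 s2 by unfold_locales (auto simp: left_slope_def right_slope_def peak_def)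

lemma eventually_good: "\<forall>\<^sub>F a in at_right 0. good a"
proof -
  have "((\<lambda>a. left_slope a - 2 * peak a) \<longlongrightarrow> s1 - 2 * (1/2)) (at_right 0)"
    by (intro tendsto_intros tendsto_left_slope tendsto_peak)
  then have 1: "\<forall>\<^sub>F a in at_right 0. 0 < left_slope a - 2 * peak a" by (rule order_tendstoD) (use s1 in simp)
  have "((\<lambda>a. right_slope a - 2 * peak a) \<longlongrightarrow> s2 - 2 * (1/2)) (at_right 0)"
    by (intro tendsto_intros tendsto_right_slope tendsto_peak)
  then have 2: "\<forall>\<^sub>F a in at_right 0. 0 < right_slope a - 2 * peak a" by (rule order_tendstoD) (use s2 in simp)
  have 3: "\<forall>\<^sub>F a in at_right 0. peak a < 1" by (rule order_tendstoD[OF tendsto_peak]) simp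
  show ?thesis using 1 2 3 pos
  proof eventually_elim
    case (elim a)
    then show ?case using r by unfold_locales (auto simp: peak_def)
  qed
qed

text \<open>
  The outer slopes of the family are written out in terms of \<open>a\<close>, while those of the locale
  are determined by the zeros \<open>c1\<close> and \<open>c2\<close>.
\<close>

lemma T_eq_W:
  assumes "good a"
  shows "w_map.T (left_slope a) (right_slope a) (peak a) = W s1 s2 p q r a"
proof -
  interpret w_map "left_slope a" "right_slope a" "peak a" by (rule assms)
  have c1': "1/2 - (1/2 + r * a) / (s1 + p * a) = c1" and c2': "1/2 + (1/2 + r * a) / (s2 + q * a) = c2"
    unfolding c1_def c2_def by (simp_all add: left_slope_def right_slope_def peak_def)
  have "c1 = (s1 - 1 + p * a - 2 * r * a) / (2 * (s1 + p * a))"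
    using S_gt_1 unfolding c1'[symmetric] by (simp add: left_slope_def field_simps)
  then have slope1: "2 * (s1 + p * a) / (s1 - 1 + p * a - 2 * r * a) = 1 / c1" by simp
  have "1 - c2 = (s2 - 1 + q * a - 2 * r * a) / (2 * (s2 + q * a))"
    using S_gt_1 unfolding c2'[symmetric] by (simp add: right_slope_def field_simps)
  then have slope2: "2 * (s2 + q * a) / (s2 - 1 + q * a - 2 * r * a) = 1 / (1 - c2)" by simp
  have "T x = W s1 s2 p q r a x" for x
    unfolding W_def c1' c2' slope1 slope2 T_def by (auto simp: left_slope_def right_slope_def peak_def)
  then show ?thesis by blast
qed

lemma admissible_if_good:
  assumes "good a" "0 \<le> a"
  shows "admissible s1 s2 p q r a"
  using w_map.T_range[OF assms(1)] assms(2) unfolding T_eq_W[OF assms(1)] by (auto simp: admissible_def)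

context
  fixes \<mu> :: "real \<Rightarrow> real measure"
  assumes acim_W: "\<And>a. admissible s1 s2 p q r a \<Longrightarrow> acim (W s1 s2 p q r a) (\<mu> a)"
begin

lemma acim_T: "good a \<Longrightarrow> 0 \<le> a \<Longrightarrow> acim (w_map.T (left_slope a) (right_slope a) (peak a)) (\<mu> a)"
  using acim_W[OF admissible_if_good] T_eq_W by simp

lemma integral_\<mu>_0:
  assumes f: "continuous_on {0..1} f"
  shows "(\<integral>x. f x \<partial>\<mu> 0) = (s2 * (s1 - 1) / (s1 + s2) * prim f 1 + prim f (1/2)) / (s2 * (s1 - 1) / (s1 + s2) + 1/2)"
proof -
  interpret w_map "left_slope 0" "right_slope 0" "peak 0" by (rule good_0)
  let ?w = "s2 * (s1 - 1) / (s1 + s2)" and ?k = "s2 / (s2 + 1)"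
  have "c1 / (c2 - c1) = (1/2 - (1/2) / s1) / ((1/2) / s2 + (1/2) / s1)"
    unfolding c1_def c2_def by (simp add: left_slope_def right_slope_def peak_def)
  then have w: "c1 / (c2 - c1) = ?w" by (simp only: branch_ratio_0)
  have "peak 0 = 1/2" by (simp add: peak_def)
  from orbit_sum_at_fixed_turning_point[OF this] have L: "orbit_sum g = ?k * g (1/2)" for g by (simp add: right_slope_def)
  have U: "unnormalized g = ?k * (?w * prim g 1 + prim g (1/2))" for g
    unfolding unnormalized_def w L by (simp only: distrib_left mult_1_right ac_simps)
  have "unnormalized (\<lambda>_. 1) = ?k * (?w + 1/2)" unfolding U by (simp add: prim_const)
  then have eq: "(\<integral>x. f x \<partial>\<mu> 0) * (?k * (?w + 1/2)) = ?k * (?w * prim f 1 + prim f (1/2))"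
    using acim_integral_unnormalized[OF acim_T[OF good_0] f] unfolding U[of f] by simp
  have "i = x / y" if "i * (k * y) = k * x" "0 < k" "0 < y" for i k x y :: real
    using that by (simp add: field_simps)
  from this[OF eq] show ?thesis using s1 s2 by (simp add: add_nonneg_pos)
qed

text \<open>
  A continuous \<open>f\<close> differs from \<open>f (1/2)\<close> by at most \<open>\<epsilon> / 2\<close> plus a multiple of a continuous function
  \<open>h\<close> vanishing near 1/2. For small \<open>a\<close> the trapping interval lies where \<open>h\<close> vanishes, so that \<open>h\<close> has
  integral 0.
\<close>

lemma trapped_limit:
  fixes f :: "real \<Rightarrow> real"
  assumes I: "s1 * s2 < s1 + s2" and f: "continuous_on {0..1} f"
  shows "((\<lambda>a. \<integral>x. f x \<partial>\<mu> a) \<longlongrightarrow> f (1/2)) (at_right 0)"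
proof (rule tendstoI)
  fix \<epsilon> :: real assume \<epsilon>: "0 < \<epsilon>"
  obtain B where B: "\<And>x. x \<in> {0..1} \<Longrightarrow> \<bar>f x\<bar> \<le> B" "0 \<le> B"
    using continuous_on_unit_bounded[OF f] by blast
  have "\<exists>\<delta>>0. \<forall>x\<in>{0..1}. dist x (1/2) < \<delta> \<longrightarrow> dist (f x) (f (1/2)) < \<epsilon> / 2"
    using f[unfolded continuous_on_iff, rule_format, of "1/2" "\<epsilon> / 2"] \<epsilon> by simp
  then obtain \<delta> where \<delta>: "0 < \<delta>" "\<And>x. x \<in> {0..1} \<Longrightarrow> \<bar>x - 1/2\<bar> < \<delta> \<Longrightarrow> \<bar>f x - f (1/2)\<bar> < \<epsilon> / 2"
    by (auto simp: dist_real_def)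
  define h where "h = (\<lambda>x::real. max 0 (\<bar>x - 1/2\<bar> - \<delta> / 2))"
  have h: "continuous_on {0..1} h" unfolding h_def by (intro continuous_intros)
  have f_le: "\<bar>f x - f (1/2)\<bar> \<le> \<epsilon> / 2 + (4 * B / \<delta>) * h x" if x: "x \<in> {0..1}" for x
  proof (cases "\<bar>x - 1/2\<bar> < \<delta>")
    case True
    then show ?thesis using \<delta>(2)[OF x] \<delta>(1) B(2) by (simp add: h_def add_increasing2 less_imp_le)
  next
    case False
    then have "4 * B / \<delta> * (\<delta> / 2) \<le> 4 * B / \<delta> * h x"
      using \<delta>(1) B(2) by (intro mult_left_mono) (auto simp: h_def)
    then have "2 * B \<le> 4 * B / \<delta> * h x" using \<delta>(1) by simp
    moreover have "\<bar>f x - f (1/2)\<bar> \<le> 2 * B" using B(1)[OF x] B(1)[of "1/2"] by (simp add: abs_le_iff)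
    ultimately show ?thesis using \<epsilon> by linarith
  qed
  have lim1: "((\<lambda>a. left_slope a + right_slope a - left_slope a * right_slope a) \<longlongrightarrow> s1 + s2 - s1 * s2) (at_right 0)"
    by (intro tendsto_intros tendsto_left_slope tendsto_right_slope)
  have e1: "\<forall>\<^sub>F a in at_right 0. 0 < left_slope a + right_slope a - left_slope a * right_slope a"
    by (rule order_tendstoD[OF lim1]) (use I in simp)
  have lim2: "((\<lambda>a. right_slope a * (peak a - 1/2)) \<longlongrightarrow> s2 * (1/2 - 1/2)) (at_right 0)"
    by (intro tendsto_intros tendsto_peak tendsto_right_slope)
  have lim3: "((\<lambda>a. peak a - right_slope a * (peak a - 1/2)) \<longlongrightarrow> 1/2 - s2 * (1/2 - 1/2)) (at_right 0)"
    by (intro tendsto_intros tendsto_peak tendsto_right_slope)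
  have e3: "\<forall>\<^sub>F a in at_right 0. 0 < peak a - right_slope a * (peak a - 1/2)"
    by (rule order_tendstoD[OF lim3]) simp
  have lim4: "((\<lambda>a. peak a - right_slope a * (peak a - 1/2) - (1/2 - peak a / left_slope a)) \<longlongrightarrow> 1/2 - s2 * (1/2 - 1/2) - (1/2 - (1/2) / s1)) (at_right 0)"
    by (intro tendsto_intros tendsto_peak tendsto_right_slope tendsto_left_slope) (use s1 in simp)
  have e4: "\<forall>\<^sub>F a in at_right 0. 0 < peak a - right_slope a * (peak a - 1/2) - (1/2 - peak a / left_slope a)"
    by (rule order_tendstoD[OF lim4]) (use s1 in simp)
  have e5: "\<forall>\<^sub>F a in at_right 0. right_slope a * (peak a - 1/2) < \<delta> / 2"
    by (rule order_tendstoD[OF lim2]) (use \<delta> in simp)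
  show "\<forall>\<^sub>F a in at_right 0. dist (\<integral>x. f x \<partial>\<mu> a) (f (1/2)) < \<epsilon>"
    using eventually_good pos e1 e3 e4 e5
  proof eventually_elim
    case (elim a)
    interpret w_map "left_slope a" "right_slope a" "peak a" by (rule elim)
    have acim: "acim T (\<mu> a)" by (rule acim_T) (use elim in auto)
    have M: "prob_space (\<mu> a)" "sets (\<mu> a) = sets unit_borel" using acim by (auto simp: acim_def)
    interpret P: prob_space "\<mu> a" by (rule M)
    have w: "0 < peak a - 1/2" using elim r by (simp add: peak_def)
    then have wS: "peak a - 1/2 \<le> right_slope a * (peak a - 1/2)" using S_gt_1 by simp
    have h0: "(\<integral>x. h x \<partial>\<mu> a) = 0"
    proof (rule trapped_integral_eq_0[OF acim])
      fix x assume "x \<in> {peak a - right_slope a * (peak a - 1/2)..peak a}"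
      then have "peak a - right_slope a * (peak a - 1/2) \<le> x" "x \<le> peak a" by auto
      then have "x - 1/2 < \<delta> / 2" "1/2 - x < \<delta> / 2" using wS w elim(6) by (linarith+)
      then show "h x = 0" by (simp add: h_def max_def abs_if)
    qed (use elim w h in \<open>auto simp: c1_def\<close>)
    note int = continuous_on_integrable_unit_borel[OF M]
    have "(\<integral>x. f x \<partial>\<mu> a) - f (1/2) = (\<integral>x. f x - f (1/2) \<partial>\<mu> a)"
      using int[OF f] by (simp add: P.prob_space)
    also have "\<bar>\<dots>\<bar> \<le> (\<integral>x. \<epsilon> / 2 + (4 * B / \<delta>) * h x \<partial>\<mu> a)"
      unfolding real_norm_def[symmetric]
    proof (rule Bochner_Integration.integral_norm_bound_integral)
      show "integrable (\<mu> a) (\<lambda>x. f x - f (1/2))" "integrable (\<mu> a) (\<lambda>x. \<epsilon> / 2 + (4 * B / \<delta>) * h x)"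
        using \<delta>(1) by (intro int continuous_intros f h; simp)+
      show "norm (f x - f (1/2)) \<le> \<epsilon> / 2 + (4 * B / \<delta>) * h x" if "x \<in> space (\<mu> a)" for x
        using f_le that unfolding space_unit_borel_measure[OF M(2)] by simp
    qed
    also have "\<dots> = \<epsilon> / 2" using int[OF h] by (simp add: h0 P.prob_space)
    finally show ?case using \<epsilon> by (simp add: dist_real_def)
  qed
qed

end

text \<open>
  The second branch has the fixed point \<open>ystar a\<close>, and \<open>geom_weight a\<close> is the total weight of an
  orbit frozen there. The distance from \<open>ystar a\<close> to the image of the turning value is \<open>eps a ^ 4\<close>.
\<close>

definition "ystar a = 1/2 - r * a / (left_slope a - 1)"
definition "geom_weight a = left_slope a / (right_slope a * (left_slope a - 1))"
definition "eps a = root 4 (r * a * (right_slope a - 1 - 1 / (left_slope a - 1)))"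

lemma tendsto_ystar: "(ystar \<longlongrightarrow> 1/2) (at_right 0)"
  unfolding ystar_def[abs_def] left_slope_def[abs_def] by (rule tendsto_eq_intros refl | use s1 in simp)+

lemma tendsto_geom_weight: "(geom_weight \<longlongrightarrow> s1 / (s2 * (s1 - 1))) (at_right 0)"
  unfolding geom_weight_def[abs_def] by (intro tendsto_intros tendsto_left_slope tendsto_right_slope) (use s1 s2 in auto)

text \<open>
  The constants of \<open>escaping_orbit_sum\<close> can be chosen independently of \<open>a\<close>: the inner slopes are at
  least \<open>s1\<close> and \<open>s2\<close>, and the distance from \<open>ystar a\<close> to the left end of the second branch tends to
  \<open>1 / (2 * s1)\<close>.
\<close>

lemma orbit_sum_expansion:
  assumes nonneg: "\<forall>\<^sub>F a in at_right 0. 0 \<le> right_slope a - 1 - 1 / (left_slope a - 1)"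
  obtains C where "\<forall>\<^sub>F a in at_right 0. \<forall>g B. (\<forall>x\<in>{0..1}. \<bar>g x\<bar> \<le> B) \<longrightarrow>
      (\<forall>x\<in>{0..1}. \<forall>y\<in>{0..1}. \<bar>g x - g y\<bar> \<le> B * \<bar>x - y\<bar>) \<longrightarrow>
      \<bar>orbit_sum_at a g - (g (peak a) - geom_weight a * g (ystar a))\<bar> \<le> C * B * eps a ^ 3"
proof -
  define t where "t = max (max (1/2) (max (1 / s1) (1 / s2))) (1 / root 4 s1)"
  define d where "d = 1 / (4 * s1)"
  have t1: "t < 1" using s1 s2 by (auto simp: t_def)
  have d: "0 < d" "d \<le> 1" using s1 by (auto simp: d_def)
  have "((\<lambda>a. ystar a - (1/2 - peak a / left_slope a)) \<longlongrightarrow> 1/2 - (1/2 - (1/2) / s1)) (at_right 0)"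
    by (intro tendsto_intros tendsto_ystar tendsto_peak tendsto_left_slope) (use s1 in simp)
  then have e1: "\<forall>\<^sub>F a in at_right 0. d < ystar a - (1/2 - peak a / left_slope a)"
    by (rule order_tendstoD) (use s1 in \<open>simp add: d_def field_simps\<close>)
  have "((\<lambda>a. peak a - right_slope a * (peak a - 1/2)) \<longlongrightarrow> 1/2 - s2 * (1/2 - 1/2)) (at_right 0)"
    by (intro tendsto_intros tendsto_peak tendsto_right_slope)
  then have e2: "\<forall>\<^sub>F a in at_right 0. 0 < peak a - right_slope a * (peak a - 1/2)"
    by (rule order_tendstoD) simp
  show ?thesis
  proof (rule that[of "2 / d / (1 - t)"])
    show "\<forall>\<^sub>F a in at_right 0. \<forall>g B. (\<forall>x\<in>{0..1}. \<bar>g x\<bar> \<le> B) \<longrightarrow>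
      (\<forall>x\<in>{0..1}. \<forall>y\<in>{0..1}. \<bar>g x - g y\<bar> \<le> B * \<bar>x - y\<bar>) \<longrightarrow>
      \<bar>orbit_sum_at a g - (g (peak a) - geom_weight a * g (ystar a))\<bar> \<le> 2 / d / (1 - t) * B * eps a ^ 3"
      using eventually_good pos nonneg e1 e2
    proof (eventually_elim, intro allI impI)
      fix a B :: real and g :: "real \<Rightarrow> real"
      assume a: "good a" "0 < a" "0 \<le> right_slope a - 1 - 1 / (left_slope a - 1)" "d < ystar a - (1/2 - peak a / left_slope a)"
        "0 < peak a - right_slope a * (peak a - 1/2)"
        and gB: "\<forall>x\<in>{0..1}. \<bar>g x\<bar> \<le> B" and gL: "\<forall>x\<in>{0..1}. \<forall>y\<in>{0..1}. \<bar>g x - g y\<bar> \<le> B * \<bar>x - y\<bar>"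
      interpret w_map "left_slope a" "right_slope a" "peak a" by (rule a)
      have S: "s1 \<le> left_slope a" "s2 \<le> right_slope a" using a p q by (auto simp: left_slope_def right_slope_def)
      have y_pos: "0 \<le> ystar a" using a(4) d c1_bounds(1) unfolding c1_def by linarith
      have "0 \<le> r * a / (left_slope a - 1)" using a r S_gt_1 by simp
      then have y_le: "ystar a \<le> 1" unfolding ystar_def by linarith
      have "\<bar>orbit_sum_at a g - (g (peak a) - left_slope a / (right_slope a * (left_slope a - 1)) * g (ystar a))\<bar> \<le> 2 * B / d * eps a ^ 3 / (1 - t)"
      proof (rule escaping_orbit_sum[where m = "root 4 (left_slope a)"])
        show "1/2 < peak a" using a r by (simp add: peak_def)
        show "right_slope a * (peak a - 1/2) < peak a" using a by simp
        show "ystar a = 1/2 - (peak a - 1/2) / (left_slope a - 1)" by (simp add: ystar_def peak_def)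
        show "(peak a - 1/2) * (right_slope a - 1 - 1 / (left_slope a - 1)) = eps a ^ 4"
          using a r by (simp add: eps_def peak_def real_root_pow_pos2)
        show "0 \<le> eps a" using a r by (simp add: eps_def real_root_ge_zero)
        show "left_slope a = root 4 (left_slope a) ^ 4" using S_gt_1 by (simp add: real_root_pow_pos2)
        show "1 < root 4 (left_slope a)" using S_gt_1 by simp
        have "1 / left_slope a \<le> 1 / s1" "1 / right_slope a \<le> 1 / s2" using S s1 s2 by (auto intro: frac_le)
        then show "rho \<le> t"
          unfolding rho_def t_def by (rule order_trans[OF max.mono[OF order_refl max.mono] max.cobounded1])
        show "1 / root 4 (left_slope a) \<le> t"
          using S s1 by (auto simp: t_def le_max_iff_disj intro!: disjI2 frac_le real_root_gt_zero)
        show "c1 + d \<le> ystar a" using a by (simp add: c1_def)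
      qed (use t1 d gB gL y_pos y_le in auto)
      then show "\<bar>orbit_sum_at a g - (g (peak a) - geom_weight a * g (ystar a))\<bar> \<le> 2 / d / (1 - t) * B * eps a ^ 3"
        by (simp add: geom_weight_def ac_simps)
    qed
  qed
qed

text \<open>
  The scale \<open>\<eta>\<close> is 1 in the noncritical and \<open>a\<close> in the critical case, and the quotient is allowed to
  tend to 0. Caratheodory's form of differentiability covers both without division by \<open>u a - 1/2\<close>.
\<close>

lemma tendsto_increment:
  fixes u \<eta> :: "real \<Rightarrow> real"
  assumes f: "continuous_on {0..1} f" and u: "(u \<longlongrightarrow> 1/2) (at_right 0)"
    and quot: "((\<lambda>a. (u a - 1/2) / \<eta> a) \<longlongrightarrow> l) (at_right 0)"
  shows "((\<lambda>a. (prim f (u a) - prim f (1/2)) / \<eta> a) \<longlongrightarrow> f (1/2) * l) (at_right 0)"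
proof -
  have "(prim f has_real_derivative f (1/2)) (at (1/2))"
    using prim_has_real_derivative[OF f, of "1/2"] at_within_interior[of "1/2::real" "{0..1}"]
    by (simp add: interior_atLeastAtMost_real)
  then obtain \<phi> where \<phi>: "\<And>x. prim f x - prim f (1/2) = \<phi> x * (x - 1/2)" "isCont \<phi> (1/2)" "\<phi> (1/2) = f (1/2)"
    by (auto simp: CARAT_DERIV)
  have "((\<lambda>a. \<phi> (u a) * ((u a - 1/2) / \<eta> a)) \<longlongrightarrow> f (1/2) * l) (at_right 0)"
    using isCont_tendsto_compose[OF \<phi>(2) u] \<phi>(3) by (intro tendsto_mult quot) simp
  then show ?thesis by (simp add: \<phi>(1))
qed

text \<open>
  The unnormalized integral, divided by \<open>\<eta>\<close>, has the limit
  \<open>\<sigma> * w\<close> times the \<open>\<mu> 0\<close>-integral plus \<open>R * f (1/2)\<close>. The first part comes from the total weight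
  \<open>1 - geom_weight a\<close> of the orbit, the second from its displacement relative to 1/2. Division by the
  value for the constant 1 gives the claim.
\<close>

lemma escaping_limit:
  fixes \<mu> :: "real \<Rightarrow> real measure" and \<eta> :: "real \<Rightarrow> real"
  assumes acim_W: "\<And>a. admissible s1 s2 p q r a \<Longrightarrow> acim (W s1 s2 p q r a) (\<mu> a)"
    and f: "continuous_on {0..1} f"
    and nonneg: "\<forall>\<^sub>F a in at_right 0. 0 \<le> right_slope a - 1 - 1 / (left_slope a - 1)"
    and eta: "\<forall>\<^sub>F a in at_right 0. 0 < \<eta> a"
    and eps: "((\<lambda>a. eps a ^ 3 / \<eta> a) \<longlongrightarrow> 0) (at_right 0)"
    and geom_weight: "((\<lambda>a. (1 - geom_weight a) / \<eta> a) \<longlongrightarrow> \<sigma>) (at_right 0)" "0 < \<sigma>"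
    and u: "((\<lambda>a. (peak a - 1/2) / \<eta> a) \<longlongrightarrow> u) (at_right 0)"
    and v: "((\<lambda>a. (ystar a - 1/2) / \<eta> a) \<longlongrightarrow> v) (at_right 0)"
    and R: "R = u - s1 / (s2 * (s1 - 1)) * v" "0 \<le> R"
    and w: "w = s2 * (s1 - 1) / (s1 + s2) + 1/2"
  shows "((\<lambda>a. \<integral>x. f x \<partial>\<mu> a) \<longlongrightarrow> (\<sigma> * w * (\<integral>x. f x \<partial>\<mu> 0) + R * f (1/2)) / (\<sigma> * w + R)) (at_right 0)"
proof -
  obtain C where C: "\<forall>\<^sub>F a in at_right 0. \<forall>g B. (\<forall>x\<in>{0..1}. \<bar>g x\<bar> \<le> B) \<longrightarrow>
      (\<forall>x\<in>{0..1}. \<forall>y\<in>{0..1}. \<bar>g x - g y\<bar> \<le> B * \<bar>x - y\<bar>) \<longrightarrow>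
      \<bar>orbit_sum_at a g - (g (peak a) - geom_weight a * g (ystar a))\<bar> \<le> C * B * eps a ^ 3"
    using orbit_sum_expansion[OF nonneg] by blast
  have rem: "((\<lambda>a. (orbit_sum_at a g - (g (peak a) - geom_weight a * g (ystar a))) / \<eta> a) \<longlongrightarrow> 0) (at_right 0)"
    if gB: "\<forall>x\<in>{0..1}. \<bar>g x\<bar> \<le> B" "\<forall>x\<in>{0..1}. \<forall>y\<in>{0..1}. \<bar>g x - g y\<bar> \<le> B * \<bar>x - y\<bar>" for g B
  proof (rule Lim_null_comparison)
    show "\<forall>\<^sub>F a in at_right 0. norm ((orbit_sum_at a g - (g (peak a) - geom_weight a * g (ystar a))) / \<eta> a) \<le> (C * B) * (eps a ^ 3 / \<eta> a)"
      using C eta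
    proof eventually_elim
      case (elim a)
      then have "\<bar>orbit_sum_at a g - (g (peak a) - geom_weight a * g (ystar a))\<bar> \<le> C * B * eps a ^ 3" using gB by blast
      then show ?case using elim(2) by (simp add: divide_right_mono)
    qed
    show "((\<lambda>a. (C * B) * (eps a ^ 3 / \<eta> a)) \<longlongrightarrow> 0) (at_right 0)"
      using tendsto_mult_left[OF eps, of "C * B"] by simp
  qed
  have total_lim: "((\<lambda>a. orbit_sum_at a (\<lambda>_. 1) / \<eta> a) \<longlongrightarrow> \<sigma>) (at_right 0)"
    using tendsto_add[OF rem[of "\<lambda>_. 1" 1] geom_weight(1)] by (simp add: add_divide_distrib[symmetric])
  have prim_lim: "((\<lambda>a. orbit_sum_at a (prim g) / \<eta> a) \<longlongrightarrow> \<sigma> * prim g (1/2) + R * g (1/2)) (at_right 0)"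
    if g: "continuous_on {0..1} g" for g
  proof -
    obtain B where B: "\<And>x. x \<in> {0..1} \<Longrightarrow> \<bar>g x\<bar> \<le> B" "0 \<le> B"
      using continuous_on_unit_bounded[OF g] by blast
    have lip: "\<bar>prim g x - prim g y\<bar> \<le> B * \<bar>x - y\<bar>" if "x \<in> {0..1}" "y \<in> {0..1}" for x y
      using prim_lipschitz[OF g B(1)] that by simp
    have bd: "\<bar>prim g x\<bar> \<le> B" if "x \<in> {0..1}" for x
      using lip[OF that, of 0] mult_left_le[of x B] that B(2) by simp
    let ?g = "prim g (1/2)"
    have "((\<lambda>a. (orbit_sum_at a (prim g) - (prim g (peak a) - geom_weight a * prim g (ystar a))) / \<eta> a
        + ((prim g (peak a) - ?g) / \<eta> a - geom_weight a * ((prim g (ystar a) - ?g) / \<eta> a) + (1 - geom_weight a) / \<eta> a * ?g))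
       \<longlongrightarrow> 0 + (g (1/2) * u - s1 / (s2 * (s1 - 1)) * (g (1/2) * v) + \<sigma> * ?g)) (at_right 0)"
      using lip bd
      by (intro tendsto_intros rem[of "prim g" B] tendsto_increment[OF g] tendsto_peak tendsto_ystar u v geom_weight(1) tendsto_geom_weight) auto
    moreover have "(\<lambda>a. (orbit_sum_at a (prim g) - (prim g (peak a) - geom_weight a * prim g (ystar a))) / \<eta> a
        + ((prim g (peak a) - ?g) / \<eta> a - geom_weight a * ((prim g (ystar a) - ?g) / \<eta> a) + (1 - geom_weight a) / \<eta> a * ?g))
      = (\<lambda>a. orbit_sum_at a (prim g) / \<eta> a)"
      by (simp add: add_divide_distrib[symmetric] diff_divide_distrib[symmetric] algebra_simps)
    ultimately show ?thesis by (simp add: R(1) algebra_simps)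
  qed
  let ?w = "s2 * (s1 - 1) / (s1 + s2)"
  define U where "U = (\<lambda>a. w_map.unnormalized (left_slope a) (right_slope a) (peak a))"
  define k where "k = (\<lambda>a. (1/2 - peak a / left_slope a) / (peak a / right_slope a + peak a / left_slope a))"
  have "(k \<longlongrightarrow> (1/2 - (1/2) / s1) / ((1/2) / s2 + (1/2) / s1)) (at_right 0)"
    unfolding k_def using s1 s2 by (intro tendsto_intros tendsto_peak tendsto_left_slope tendsto_right_slope) (auto simp: add_eq_0_iff field_simps)
  also note branch_ratio_0
  finally have k: "(k \<longlongrightarrow> ?w) (at_right 0)" .
  have U: "((\<lambda>a. U a g / \<eta> a) \<longlongrightarrow> ?w * \<sigma> * prim g 1 + (\<sigma> * prim g (1/2) + R * g (1/2))) (at_right 0)"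
    if g: "continuous_on {0..1} g" for g
  proof (rule Lim_transform_eventually)
    show "((\<lambda>a. k a * (orbit_sum_at a (\<lambda>_. 1) / \<eta> a) * prim g 1 + orbit_sum_at a (prim g) / \<eta> a) \<longlongrightarrow>
       ?w * \<sigma> * prim g 1 + (\<sigma> * prim g (1/2) + R * g (1/2))) (at_right 0)"
      by (intro tendsto_intros k total_lim prim_lim g)
    show "\<forall>\<^sub>F a in at_right 0. k a * (orbit_sum_at a (\<lambda>_. 1) / \<eta> a) * prim g 1 + orbit_sum_at a (prim g) / \<eta> a = U a g / \<eta> a"
      using eventually_good
    proof eventually_elim
      case (elim a)
      interpret w_map "left_slope a" "right_slope a" "peak a" by (rule elim)
      show ?case by (simp add: U_def unnormalized_def k_def c1_def c2_def add_divide_distrib)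
    qed
  qed
  have w_pos: "0 < w" unfolding w using s1 s2 by (intro add_nonneg_pos) auto
  have U1: "((\<lambda>a. U a (\<lambda>_. 1) / \<eta> a) \<longlongrightarrow> \<sigma> * w + R) (at_right 0)"
    using U[of "\<lambda>_. 1"] by (simp add: prim_const w algebra_simps)
  have den: "0 < \<sigma> * w + R" using geom_weight(2) w_pos R(2) by (intro add_pos_nonneg) auto
  have Uf: "?w * \<sigma> * prim f 1 + (\<sigma> * prim f (1/2) + R * f (1/2)) = \<sigma> * w * (\<integral>x. f x \<partial>\<mu> 0) + R * f (1/2)"
  proof -
    have "(\<integral>x. f x \<partial>\<mu> 0) = (?w * prim f 1 + prim f (1/2)) / w"
      using integral_\<mu>_0[OF acim_W f] unfolding w .
    then have "w * (\<integral>x. f x \<partial>\<mu> 0) = ?w * prim f 1 + prim f (1/2)" using w_pos by simp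
    then show ?thesis by (simp only: mult.assoc) (simp only: distrib_left mult.left_commute mult.commute add.assoc)
  qed
  show ?thesis
  proof (rule Lim_transform_eventually)
    show "((\<lambda>a. (U a f / \<eta> a) / (U a (\<lambda>_. 1) / \<eta> a)) \<longlongrightarrow>
       (\<sigma> * w * (\<integral>x. f x \<partial>\<mu> 0) + R * f (1/2)) / (\<sigma> * w + R)) (at_right 0)"
      using U[OF f] unfolding Uf by (intro tendsto_divide U1) (use den in auto)
    show "\<forall>\<^sub>F a in at_right 0. (U a f / \<eta> a) / (U a (\<lambda>_. 1) / \<eta> a) = (\<integral>x. f x \<partial>\<mu> a)"
      using order_tendstoD(1)[OF U1 den] eta eventually_good pos
    proof eventually_elim
      case (elim a)
      have "(\<integral>x. f x \<partial>\<mu> a) * U a (\<lambda>_. 1) = U a f"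
        unfolding U_def by (rule w_map.acim_integral_unnormalized[OF elim(3) acim_T[OF acim_W elim(3)] f]) (use elim in auto)
      moreover have "U a (\<lambda>_. 1) \<noteq> 0" using elim(1) by auto
      ultimately show ?case using elim(2) by (simp add: field_simps)
    qed
  qed
qed

lemma subcritical_limit:
  fixes \<mu> :: "real \<Rightarrow> real measure"
  assumes acim_W: "\<And>a. admissible s1 s2 p q r a \<Longrightarrow> acim (W s1 s2 p q r a) (\<mu> a)"
    and f: "continuous_on {0..1} (f :: real \<Rightarrow> real)" and III: "s1 + s2 < s1 * s2"
  shows "((\<lambda>a. \<integral>x. f x \<partial>\<mu> a) \<longlongrightarrow> (\<integral>x. f x \<partial>\<mu> 0)) (at_right 0)"
proof -
  have lim: "((\<lambda>a. right_slope a - 1 - 1 / (left_slope a - 1)) \<longlongrightarrow> s2 - 1 - 1 / (s1 - 1)) (at_right 0)"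
    by (intro tendsto_intros tendsto_left_slope tendsto_right_slope) (use s1 in simp)
  have gap: "0 < s2 - 1 - 1 / (s1 - 1)" using III s1 by (simp add: field_simps)
  have nonneg: "\<forall>\<^sub>F a in at_right 0. 0 \<le> right_slope a - 1 - 1 / (left_slope a - 1)"
    using order_tendstoD(1)[OF lim gap] by eventually_elim simp
  have "((\<lambda>a. root 4 (r * a * (right_slope a - 1 - 1 / (left_slope a - 1)))) \<longlongrightarrow> root 4 (r * 0 * (s2 - 1 - 1 / (s1 - 1)))) (at_right 0)"
    by (intro tendsto_intros lim)
  then have "(eps \<longlongrightarrow> 0) (at_right 0)" by (simp add: eps_def[abs_def])
  from tendsto_power[OF this, of 3] have eps: "((\<lambda>a. eps a ^ 3 / 1) \<longlongrightarrow> 0) (at_right 0)" by simp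
  have geom_weight: "((\<lambda>a. (1 - geom_weight a) / 1) \<longlongrightarrow> 1 - s1 / (s2 * (s1 - 1))) (at_right 0)"
    using tendsto_diff[OF tendsto_const tendsto_geom_weight, of 1] by simp
  have K0: "0 < 1 - s1 / (s2 * (s1 - 1))" using III s1 s2 by (simp add: field_simps)
  have u: "((\<lambda>a. (peak a - 1/2) / 1) \<longlongrightarrow> 0) (at_right 0)" using tendsto_diff[OF tendsto_peak tendsto_const, of "1/2"] by simp
  have v: "((\<lambda>a. (ystar a - 1/2) / 1) \<longlongrightarrow> 0) (at_right 0)" using tendsto_diff[OF tendsto_ystar tendsto_const, of "1/2"] by simp
  have "((\<lambda>a. \<integral>x. f x \<partial>\<mu> a) \<longlongrightarrow> ((1 - s1 / (s2 * (s1 - 1))) * (s2 * (s1 - 1) / (s1 + s2) + 1/2) * (\<integral>x. f x \<partial>\<mu> 0) + 0 * f (1/2))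
      / ((1 - s1 / (s2 * (s1 - 1))) * (s2 * (s1 - 1) / (s1 + s2) + 1/2) + 0)) (at_right 0)"
    by (rule escaping_limit[OF acim_W f nonneg _ eps geom_weight K0 u v _ _ refl]) auto
  moreover have "0 < s2 * (s1 - 1) / (s1 + s2) + 1/2" using s1 s2 by (intro add_nonneg_pos) auto
  moreover have "(k * w * i + 0 * y) / (k * w + 0) = i" if "0 < k" "0 < w" for k w i y :: real
    using that by simp
  ultimately show ?thesis using K0 by metis
qed

text \<open>
  The scale is \<open>\<eta> a = a\<close>. Criticality makes \<open>(left_slope a - 1) * (right_slope a - 1) - 1\<close> vanish
  at 0 with derivative \<open>Q\<close>. The distance of the orbit to the fixed point carries this factor and
  a further factor \<open>a\<close>, so \<open>eps a ^ 4\<close> is of order \<open>a\<^sup>2\<close> and \<open>eps a ^ 3\<close> is \<open>o(a)\<close>.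
\<close>

lemma critical_limit:
  fixes \<mu> :: "real \<Rightarrow> real measure"
  assumes acim_W: "\<And>a. admissible s1 s2 p q r a \<Longrightarrow> acim (W s1 s2 p q r a) (\<mu> a)"
    and f: "continuous_on {0..1} (f :: real \<Rightarrow> real)" and II: "s1 + s2 = s1 * s2"
    and Q: "Q = q * s1 + p * s2 - p - q"
  shows "((\<lambda>a. \<integral>x. f x \<partial>\<mu> a) \<longlongrightarrow>
     (Q * (s2 + 2) * (\<integral>x. f x \<partial>\<mu> 0) + 2 * r * s1 * s2\<^sup>2 * f (1/2)) / (Q * (s2 + 2) + 2 * r * s1 * s2\<^sup>2)) (at_right 0)"
proof -
  have prod: "(s1 - 1) * (s2 - 1) = 1" using II by (simp add: algebra_simps)
  have s21: "s2 * (s1 - 1) = s1" using II by (simp add: algebra_simps)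
  have Q_pos: "0 < Q" unfolding Q
  proof -
    have "0 < q * (s1 - 1) + p * (s2 - 1)" using p q s1 s2 by (intro add_pos_pos mult_pos_pos) auto
    then show "0 < q * s1 + p * s2 - p - q" by (simp add: algebra_simps)
  qed
  have E: "(left_slope a - 1) * (right_slope a - 1) - 1 = a * (Q + p * q * a)" for a
    using prod by (simp add: left_slope_def right_slope_def Q algebra_simps)
  define G where "G = (\<lambda>a. (Q + p * q * a) / (left_slope a - 1))"
  have sl1: "0 < left_slope a - 1" "0 < right_slope a" if "0 < a" for a
    using s1 s2 mult_pos_pos[OF p that] mult_pos_pos[OF q that] by (auto simp: left_slope_def right_slope_def)
  have gapG: "right_slope a - 1 - 1 / (left_slope a - 1) = a * G a" if "0 < a" for a
  proof -
    have "right_slope a - 1 - 1 / (left_slope a - 1) = ((left_slope a - 1) * (right_slope a - 1) - 1) / (left_slope a - 1)"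
      using sl1(1)[OF that] by (simp add: field_simps)
    then show ?thesis by (simp add: E G_def)
  qed
  have G: "(G \<longlongrightarrow> (Q + p * q * 0) / (s1 - 1)) (at_right 0)"
    unfolding G_def by (intro tendsto_intros tendsto_left_slope) (use s1 in simp)
  have G_pos: "0 \<le> G a" if "0 < a" for a
    using that Q_pos p q sl1(1)[OF that] by (simp add: G_def)
  have nonneg: "\<forall>\<^sub>F a in at_right 0. 0 \<le> right_slope a - 1 - 1 / (left_slope a - 1)"
    using pos by eventually_elim (simp add: gapG G_pos)
  have eps: "((\<lambda>a. eps a ^ 3 / a) \<longlongrightarrow> 0) (at_right 0)"
  proof (rule Lim_transform_eventually)
    have "((\<lambda>a. root 4 ((r * G a) ^ 3 * a ^ 2)) \<longlongrightarrow> root 4 ((r * ((Q + p * q * 0) / (s1 - 1))) ^ 3 * 0 ^ 2)) (at_right 0)"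
      by (intro tendsto_intros G)
    then show "((\<lambda>a. root 4 ((r * G a) ^ 3 * a ^ 2)) \<longlongrightarrow> 0) (at_right 0)" by simp
    show "\<forall>\<^sub>F a in at_right 0. root 4 ((r * G a) ^ 3 * a ^ 2) = eps a ^ 3 / a"
      using pos
    proof eventually_elim
      case (elim a)
      have "eps a ^ 3 = root 4 ((r * a * (a * G a)) ^ 3)"
        unfolding eps_def gapG[OF elim] by (simp add: real_root_power)
      also have "(r * a * (a * G a)) ^ 3 = ((r * G a) ^ 3 * a ^ 2) * a ^ 4"
        by (simp add: power_mult_distrib ac_simps flip: power_add)
      also have "root 4 \<dots> = root 4 ((r * G a) ^ 3 * a ^ 2) * a"
        using elim by (simp add: real_root_mult real_root_power_cancel)
      finally show ?case using elim by simp
    qed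
  qed
  have geom_weight: "((\<lambda>a. (1 - geom_weight a) / a) \<longlongrightarrow> Q / s1) (at_right 0)"
  proof (rule Lim_transform_eventually)
    have "((\<lambda>a. (Q + p * q * a) / (right_slope a * (left_slope a - 1))) \<longlongrightarrow> (Q + p * q * 0) / (s2 * (s1 - 1))) (at_right 0)"
      by (intro tendsto_intros tendsto_left_slope tendsto_right_slope) (use s1 s2 in simp)
    then show "((\<lambda>a. (Q + p * q * a) / (right_slope a * (left_slope a - 1))) \<longlongrightarrow> Q / s1) (at_right 0)" by (simp add: s21)
    show "\<forall>\<^sub>F a in at_right 0. (Q + p * q * a) / (right_slope a * (left_slope a - 1)) = (1 - geom_weight a) / a"
      using pos
    proof eventually_elim
      case (elim a)
      have "1 - geom_weight a = (right_slope a * (left_slope a - 1) - left_slope a) / (right_slope a * (left_slope a - 1))"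
        using sl1[OF elim] by (simp add: geom_weight_def diff_divide_distrib)
      also have "right_slope a * (left_slope a - 1) - left_slope a = a * (Q + p * q * a)"
        unfolding E[symmetric] by (simp add: algebra_simps)
      finally show ?case using elim by simp
    qed
  qed
  have u: "((\<lambda>a. (peak a - 1/2) / a) \<longlongrightarrow> r) (at_right 0)"
    by (rule Lim_transform_eventually[OF tendsto_const]) (use pos in eventually_elim, simp add: peak_def)
  have v: "((\<lambda>a. (ystar a - 1/2) / a) \<longlongrightarrow> - r / (s1 - 1)) (at_right 0)"
  proof (rule Lim_transform_eventually)
    show "((\<lambda>a. - r / (left_slope a - 1)) \<longlongrightarrow> - r / (s1 - 1)) (at_right 0)"
      by (intro tendsto_intros tendsto_left_slope) (use s1 in simp)
    show "\<forall>\<^sub>F a in at_right 0. - r / (left_slope a - 1) = (ystar a - 1/2) / a"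
      using pos by eventually_elim (simp add: ystar_def)
  qed
  have R: "r * s2 = r - s1 / (s2 * (s1 - 1)) * (- r / (s1 - 1))"
    unfolding s21 using s1 s21 by (simp add: field_simps)
  have w: "(s2 + 2) / (2 * s2) = s2 * (s1 - 1) / (s1 + s2) + 1/2"
    unfolding s21 II using s1 s2 by (simp add: field_simps)
  have "((\<lambda>a. \<integral>x. f x \<partial>\<mu> a) \<longlongrightarrow> (Q / s1 * ((s2 + 2) / (2 * s2)) * (\<integral>x. f x \<partial>\<mu> 0) + r * s2 * f (1/2))
      / (Q / s1 * ((s2 + 2) / (2 * s2)) + r * s2)) (at_right 0)"
    by (rule escaping_limit[OF acim_W f nonneg pos eps geom_weight _ u v R _ w]) (use Q_pos s1 s2 r in auto)
  also have "(Q / s1 * ((s2 + 2) / (2 * s2)) * I + r * s2 * F) / (Q / s1 * ((s2 + 2) / (2 * s2)) + r * s2) =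
      (Q * (s2 + 2) * I + 2 * r * s1 * s2\<^sup>2 * F) / (Q * (s2 + 2) + 2 * r * s1 * s2\<^sup>2)" for I F
  proof -
    have k: "2 * s1 * s2 \<noteq> 0" using s1 s2 by simp
    have Qw: "Q / s1 * ((s2 + 2) / (2 * s2)) * (2 * s1 * s2) = Q * (s2 + 2)"
      using s1 s2 by (simp add: divide_simps)
    have rs: "r * s2 * (2 * s1 * s2) = 2 * r * s1 * s2\<^sup>2" by (simp add: power2_eq_square)
    have "(x * I + y * F) * orbit = (x * orbit) * I + (y * orbit) * F" "(x + y) * orbit = x * orbit + y * orbit" for x y orbit :: real
      by (simp_all add: algebra_simps)
    note e = this[of "Q / s1 * ((s2 + 2) / (2 * s2))" "r * s2" "2 * s1 * s2", unfolded Qw rs]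
    show ?thesis using mult_divide_mult_cancel_right[OF k] e by metis
  qed
  finally show ?thesis .
qed

end

section \<open>Weak limits\<close>

lemma nn_integral_lincomb_measure:
  assumes sets: "sets N = sets M" and f: "f \<in> borel_measurable M"
  shows "(\<integral>\<^sup>+x. f x \<partial>lincomb_measure c M d N) = ennreal c * (\<integral>\<^sup>+x. f x \<partial>M) + ennreal d * (\<integral>\<^sup>+x. f x \<partial>N)"
  using f
proof (induction f rule: borel_measurable_induct)
  case (cong f g)
  have "space N = space M" using sets by (rule sets_eq_imp_space_eq)
  then show ?case using cong by (simp cong: nn_integral_cong_simp)
next
  case (set A)
  then show ?case by (simp add: sets emeasure_lincomb_measure)
next
  case (mult u k)
  have "u \<in> borel_measurable N" "u \<in> borel_measurable (lincomb_measure c M d N)"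
    using mult(2) sets by (simp_all cong: measurable_cong_sets)
  then show ?case using mult by (simp add: nn_integral_cmult distrib_left ac_simps)
next
  case (add u v)
  have m: "w \<in> borel_measurable N" "w \<in> borel_measurable (lincomb_measure c M d N)"
    if "w \<in> borel_measurable M" for w :: "_ \<Rightarrow> ennreal"
    using that sets by (simp_all cong: measurable_cong_sets)
  have uv: "u \<in> borel_measurable M" "v \<in> borel_measurable M" by (fact+)
  show ?case
    unfolding nn_integral_add[OF uv(2,1)] nn_integral_add[OF m(1)[OF uv(2)] m(1)[OF uv(1)]]
      nn_integral_add[OF m(2)[OF uv(2)] m(2)[OF uv(1)]] add.IH distrib_left
    by (simp only: ac_simps)
next
  case (seq U)
  have m: "U i \<in> borel_measurable N" "U i \<in> borel_measurable (lincomb_measure c M d N)" for i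
    using seq(1)[of i] sets by (simp_all cong: measurable_cong_sets)
  have inc: "incseq (\<lambda>i. k * (\<integral>\<^sup>+x. U i x \<partial>L))" for L and k :: ennreal
    using seq(3) by (auto simp: incseq_def le_fun_def intro!: mult_left_mono nn_integral_mono)
  have "(\<integral>\<^sup>+x. (SUP i. U i) x \<partial>L) = (SUP i. \<integral>\<^sup>+x. U i x \<partial>L)" if "\<And>i. U i \<in> borel_measurable L" for L
    using nn_integral_monotone_convergence_SUP[OF seq(3) that] by (simp add: image_comp)
  note S = this[OF seq(1)] this[OF m(1)] this[OF m(2)]
  have "(SUP i. ennreal c * (\<integral>\<^sup>+x. U i x \<partial>M) + ennreal d * (\<integral>\<^sup>+x. U i x \<partial>N)) =
      (SUP i. ennreal c * (\<integral>\<^sup>+x. U i x \<partial>M)) + (SUP i. ennreal d * (\<integral>\<^sup>+x. U i x \<partial>N))"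
    by (rule ennreal_SUP_add[OF inc inc])
  then show ?case
    unfolding S seq.IH by (simp only: SUP_mult_left_ennreal)
qed

text \<open>
  Used to read the limit functional of the critical case as an integral against the
  stated combination of measures.
\<close>

lemma integral_lincomb_measure:
  fixes f :: "'a \<Rightarrow> real"
  assumes sets: "sets N = sets M" and c: "0 \<le> c" and d: "0 \<le> d"
    and M: "integrable M f" and N: "integrable N f"
  shows "(\<integral>x. f x \<partial>lincomb_measure c M d N) = c * (\<integral>x. f x \<partial>M) + d * (\<integral>x. f x \<partial>N)"
proof -
  let ?L = "lincomb_measure c M d N"
  have fm: "f \<in> borel_measurable M" using M by auto
  then have fL: "f \<in> borel_measurable ?L" by (simp cong: measurable_cong_sets)
  have nn: "(\<integral>\<^sup>+x. ennreal (g x) \<partial>?L) = ennreal c * (\<integral>\<^sup>+x. ennreal (g x) \<partial>M) + ennreal d * (\<integral>\<^sup>+x. ennreal (g x) \<partial>N)"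
    if "g \<in> borel_measurable M" for g :: "'a \<Rightarrow> real"
    by (rule nn_integral_lincomb_measure[OF sets]) (use that in measurable)
  have fin: "(\<integral>\<^sup>+x. ennreal (g x) \<partial>K) < \<infinity>" if "integrable K g" for g :: "'a \<Rightarrow> real" and K
  proof -
    have "(\<integral>\<^sup>+x. ennreal (g x) \<partial>K) \<le> (\<integral>\<^sup>+x. ennreal (norm (g x)) \<partial>K)"
      by (intro nn_integral_mono ennreal_leI) simp
    then show ?thesis using that unfolding integrable_iff_bounded by (auto intro: le_less_trans)
  qed
  have L: "integrable ?L f"
    unfolding integrable_iff_bounded
  proof (intro conjI fL)
    have "(\<integral>\<^sup>+x. ennreal (norm (f x)) \<partial>M) < \<infinity>" "(\<integral>\<^sup>+x. ennreal (norm (f x)) \<partial>N) < \<infinity>"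
      using M N by (auto simp: integrable_iff_bounded)
    then show "(\<integral>\<^sup>+x. ennreal (norm (f x)) \<partial>?L) < \<infinity>"
      using fm by (subst nn) (auto simp: ennreal_mult_less_top)
  qed
  have e: "enn2real (\<integral>\<^sup>+x. ennreal (g x) \<partial>?L) = c * enn2real (\<integral>\<^sup>+x. ennreal (g x) \<partial>M) + d * enn2real (\<integral>\<^sup>+x. ennreal (g x) \<partial>N)"
    if "integrable M g" "integrable N g" for g
    using that fin[OF that(1)] fin[OF that(2)] c d
    by (subst nn) (auto simp: enn2real_plus enn2real_mult ennreal_mult_less_top)
  show ?thesis
    unfolding real_lebesgue_integral_def[OF L] real_lebesgue_integral_def[OF M] real_lebesgue_integral_def[OF N]
    using e[OF M N] e[of "\<lambda>x. - f x"] M N by (simp add: algebra_simps)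
qed

theorem theorem1:
  fixes s1 s2 p q r :: real and \<mu> :: "real \<Rightarrow> real measure"
  assumes "s1 > 1" and "s2 > 1" and "p > 0" and "q > 0" and "r > 0"
    and "\<And>a. admissible s1 s2 p q r a \<Longrightarrow> acim (W s1 s2 p q r a) (\<mu> a)"
  shows "(1 / s1 + 1 / s2 > 1 \<longrightarrow>
            weak_star_conv \<mu> (return unit_borel (1/2)) (at_right 0)) \<and>
         (1 / s1 + 1 / s2 = 1 \<longrightarrow>
            weak_star_conv \<mu>
              (lincomb_measure
                 ((q * s1 + p * s2 - p - q) * (s2 + 2) /
                    ((q * s1 + p * s2 - p - q) * (s2 + 2) + 2 * r * s1 * s2\<^sup>2))
                 (\<mu> 0)
                 (2 * r * s1 * s2\<^sup>2 /
                    ((q * s1 + p * s2 - p - q) * (s2 + 2) + 2 * r * s1 * s2\<^sup>2))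
                 (return unit_borel (1/2)))
              (at_right 0)) \<and>
         (1 / s1 + 1 / s2 < 1 \<longrightarrow>
            weak_star_conv \<mu> (\<mu> 0) (at_right 0))"
proof -
  interpret w_family s1 s2 p q r using assms(1-5) by unfold_locales
  have acim_W: "\<And>a. admissible s1 s2 p q r a \<Longrightarrow> acim (W s1 s2 p q r a) (\<mu> a)" by (rule assms(6))
  have "acim (w_map.T (left_slope 0) (right_slope 0) (peak 0)) (\<mu> 0)" by (rule acim_T[OF acim_W good_0]) auto
  then have \<mu>0: "prob_space (\<mu> 0)" "sets (\<mu> 0) = sets unit_borel" by (auto simp: acim_def)
  have ret: "prob_space (return unit_borel (1/2 :: real))"
    by (rule prob_space_return) (simp add: space_restrict_space)
  have int_ret: "(\<integral>x. f x \<partial>return unit_borel (1/2 :: real)) = f (1/2)" if "continuous_on {0..1} f" for f :: "real \<Rightarrow> real"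
    using borel_measurable_continuous_on_restrict[OF that]
    by (intro integral_return) (auto simp: space_restrict_space)
  have inv: "1 / s1 + 1 / s2 = (s1 + s2) / (s1 * s2)" using s1 s2 by (simp add: field_simps)
  show ?thesis
  proof (intro conjI impI)
    assume "1 / s1 + 1 / s2 > 1"
    then have "s1 * s2 < s1 + s2" unfolding inv using s1 s2 by (simp add: less_divide_eq)
    then show "weak_star_conv \<mu> (return unit_borel (1/2)) (at_right 0)"
      unfolding weak_star_conv_def using trapped_limit[OF acim_W] int_ret by simp
  next
    assume "1 / s1 + 1 / s2 < 1"
    then have "s1 + s2 < s1 * s2" unfolding inv using s1 s2 by (simp add: divide_less_eq)
    then show "weak_star_conv \<mu> (\<mu> 0) (at_right 0)"
      unfolding weak_star_conv_def using subcritical_limit[OF acim_W] by blast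
  next
    assume "1 / s1 + 1 / s2 = 1"
    then have II: "s1 + s2 = s1 * s2" unfolding inv using s1 s2 by (simp add: divide_eq_eq)
    let ?Q = "q * s1 + p * s2 - p - q"
    let ?x = "?Q * (s2 + 2)" and ?y = "2 * r * s1 * s2\<^sup>2"
    have "0 < q * (s1 - 1) + p * (s2 - 1)" using p q s1 s2 by (intro add_pos_pos mult_pos_pos) auto
    then have "0 < ?Q" by (simp add: algebra_simps)
    then have xy: "0 \<le> ?x" "0 \<le> ?y" using r s1 s2 by auto
    show "weak_star_conv \<mu> (lincomb_measure (?x / (?x + ?y)) (\<mu> 0) (?y / (?x + ?y)) (return unit_borel (1/2))) (at_right 0)"
      unfolding weak_star_conv_def
    proof (intro allI impI)
      fix f :: "real \<Rightarrow> real" assume f: "continuous_on {0..1} f"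
      have "(\<integral>x. f x \<partial>lincomb_measure (?x / (?x + ?y)) (\<mu> 0) (?y / (?x + ?y)) (return unit_borel (1/2)))
        = ?x / (?x + ?y) * (\<integral>x. f x \<partial>\<mu> 0) + ?y / (?x + ?y) * (\<integral>x. f x \<partial>return unit_borel (1/2))"
      proof (rule integral_lincomb_measure)
        show "sets (return unit_borel (1/2 :: real)) = sets (\<mu> 0)" using \<mu>0 by simp
        show "0 \<le> ?x / (?x + ?y)" "0 \<le> ?y / (?x + ?y)"
          using divide_nonneg_nonneg[OF xy(1) add_nonneg_nonneg[OF xy]] divide_nonneg_nonneg[OF xy(2) add_nonneg_nonneg[OF xy]] by (blast+)
        show "integrable (\<mu> 0) f" by (rule continuous_on_integrable_unit_borel[OF \<mu>0 f])
        show "integrable (return unit_borel (1/2)) f"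
          by (rule continuous_on_integrable_unit_borel[OF ret sets_return f])
      qed
      also have "\<dots> = (?x * (\<integral>x. f x \<partial>\<mu> 0) + ?y * f (1/2)) / (?x + ?y)"
        by (simp only: int_ret[OF f] add_divide_distrib times_divide_eq_left)
      finally have I: "(\<integral>x. f x \<partial>lincomb_measure (?x / (?x + ?y)) (\<mu> 0) (?y / (?x + ?y)) (return unit_borel (1/2)))
         = (?x * (\<integral>x. f x \<partial>\<mu> 0) + ?y * f (1/2)) / (?x + ?y)" .
      show "((\<lambda>a. \<integral>x. f x \<partial>\<mu> a) \<longlongrightarrow>
        (\<integral>x. f x \<partial>lincomb_measure (?x / (?x + ?y)) (\<mu> 0) (?y / (?x + ?y)) (return unit_borel (1/2)))) (at_right 0)"
        unfolding I by (rule critical_limit[OF acim_W f II refl])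
    qed
  qed
qed

end
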